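(* Let $\Sigma_N=\{0,s,p,N\}$ and let $H$ be the 2-Hydra formula. Then the sequent $\vdash H$ has a proof in the cyclic proof system $\mathrm{CLKID}^\omega(\Sigma_N,\Phi_N)$, but $H$ has no proof in $\mathrm{LKID}(\Sigma_N,\Phi_N)$ extended by the $(0,s)$-axioms $\forall x\,(N(x)\to sx\neq 0)$ and $\forall x\,\forall y\,(N(x)\wedge N(y)\to (sx=sy\to x=y))$.
   Context: Signature $\Sigma_N$: constant $0$, unary function $s$ (successor), an ordinary binary predicate symbol $p$, and an inductive unary predicate $N$, with equality. $\Phi_N$ consists of the two productions: $N(0)$ (no premises), and from $N(x)$ infer $N(sx)$. Write $1=s0$, $2=ss0$, $\forall x\in N.\,A$ for $\forall x(N(x)\to A)$, and $A_1,\dots,A_n\to B$ for $A_1\wedge\dots\wedge A_n\to B$. The 2-Hydra formula is $H=(H_a,H_b,H_c,H_d\to \forall x,y\in N.\,p(x,y))$ where $H_a$: $\forall x\in N.\ p(0,0)\wedge p(1,0)\wedge p(x,1)$; $H_b$: $\forall x,y\in N.\ p(x,y)\to p(sx,ssy)$; $H_c$: $\forall y\in N.\ p(sy,y)\to p(0,ssy)$; $H_d$: $\forall x\in N.\ p(sx,x)\to p(ssx,0)$. $\mathrm{LKID}(\Sigma_N,\Phi_N)$ is the classical sequent calculus (sequents $\Gamma\vdash\Delta$ with $\Gamma,\Delta$ finite sets of formulas, contraction implicit) with: axiom $\Gamma\vdash\Delta$ when $\Gamma\cap\Delta\neq\emptyset$; weakening; cut; substitution (from $\Gamma\vdash\Delta$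 infer $\Gamma[\theta]\vdash\Delta[\theta]$); the standard left and right rules for $\neg,\wedge,\vee,\to,\forall,\exists$ (with the usual eigenvariable conditions); equality rules $\Gamma\vdash t=t,\Delta$ and (from $\Gamma[u/x,t/y]\vdash\Delta[u/x,t/y]$ infer $\Gamma[t/x,u/y],t=u\vdash\Delta[t/x,u/y]$); right rules for $N$: $\Gamma\vdash\Delta,N0$ and (from $\Gamma\vdash\Delta,Nt$ infer $\Gamma\vdash\Delta,N(st)$); and the induction rule: from $\Gamma\vdash F0,\Delta$, $\Gamma,Fx\vdash F(sx),\Delta$ ($x$ fresh) and $\Gamma,Ft\vdash\Delta$ infer $\Gamma,Nt\vdash\Delta$, for any formula $F$. Proofs are finite derivation trees all of whose leaves are axioms. $\mathrm{CLKID}^\omega(\Sigma_N,\Phi_N)$ has the same rules except that the induction rule is replaced by the case-split rule: from $\Gamma,t=0\vdash\Delta$ and $\Gamma,t=sx,Nx\vdash\Delta$ ($x$ not free in $\Gamma,\Delta,Nt$) infer $\Gamma,Nt\vdash\Delta$; the formula $Nx$ is the case-descendant of the principal formula $Nt$. A cyclic pre-proof is a finite derivation tree in which every leaf that is not an axiom (a bud) is assigned a companion, an inner node labelled by the same sequent; unfolding gives a possibly infinite tree. A trace along an infinite path $(\Gamma_i\vdash\Delta_i)_{i}$ is a sequence of atoms $\tau_i\in\Gamma_i$ of the form $N(t)$ with: $\tau_i=\tau_{i+1}[\theta]$ at a substitution rule with substitution $\theta$; at an equality-left rule with principal $t=u$, $\tau_i=F[t/x,u/y]$ and $\tau_{i+1}=F[u/x,t/y]$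 for some $F$; at a case-split rule either $\tau_{i+1}=\tau_i$ or $\tau_i$ is the principal formula and $\tau_{i+1}$ its case-descendant (then $i$ is a progress point); at all other rules $\tau_{i+1}=\tau_i$. A cyclic proof is a cyclic pre-proof whose unfolding satisfies the global trace condition: every infinite path has a tail along which there is a trace with infinitely many progress points. *)

theory Defs
  imports Main "HOL-Library.FSet"
begin

section \<open>Formulas over 0, s, p, N with equality\<close>

datatype tm = Var nat | Zero | Sc tm

text \<open>
  De Bruijn representation: \<^term>\<open>Var 0\<close> directly below \<open>All\<close> or \<open>Ex\<close> is the
  bound variable, and an index that reaches beyond all enclosing quantifiers is a free variable.
  Thus \<open>Var x\<close> at top level is the free variable number \<open>x\<close>, and substitution is
  automatically capture-avoiding.
\<close>

datatype fm =
    Eql tm tm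
  | PAtom tm tm
  | NAtom tm
  | Neg fm
  | Conj fm fm
  | Disj fm fm
  | Imp fm fm
  | All fm
  | Ex fm

primrec tsubst :: "(nat \<Rightarrow> tm) \<Rightarrow> tm \<Rightarrow> tm" where
  "tsubst \<theta> (Var x) = \<theta> x"
| "tsubst \<theta> Zero = Zero"
| "tsubst \<theta> (Sc t) = Sc (tsubst \<theta> t)"

definition lift :: "(nat \<Rightarrow> tm) \<Rightarrow> nat \<Rightarrow> tm" where
  "lift \<theta> = case_nat (Var 0) (\<lambda>x. tsubst (\<lambda>y. Var (Suc y)) (\<theta> x))"

primrec subst :: "(nat \<Rightarrow> tm) \<Rightarrow> fm \<Rightarrow> fm" where
  "subst \<theta> (Eql t u) = Eql (tsubst \<theta> t) (tsubst \<theta> u)"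
| "subst \<theta> (PAtom t u) = PAtom (tsubst \<theta> t) (tsubst \<theta> u)"
| "subst \<theta> (NAtom t) = NAtom (tsubst \<theta> t)"
| "subst \<theta> (Neg A) = Neg (subst \<theta> A)"
| "subst \<theta> (Conj A B) = Conj (subst \<theta> A) (subst \<theta> B)"
| "subst \<theta> (Disj A B) = Disj (subst \<theta> A) (subst \<theta> B)"
| "subst \<theta> (Imp A B) = Imp (subst \<theta> A) (subst \<theta> B)"
| "subst \<theta> (All A) = All (subst (lift \<theta>) A)"
| "subst \<theta> (Ex A) = Ex (subst (lift \<theta>) A)"

text \<open>
  \<open>inst A t\<close> is the instance \<open>A(t)\<close> of the body \<open>A\<close> of a quantified
  formula: index 0 becomes \<open>t\<close> and the other indices move down by one.
\<close>

definition inst :: "fm \<Rightarrow> tm \<Rightarrow> fm" where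
  "inst A t = subst (case_nat t Var) A"

primrec tfv :: "tm \<Rightarrow> nat set" where
  "tfv (Var x) = {x}"
| "tfv Zero = {}"
| "tfv (Sc t) = tfv t"

primrec fv :: "fm \<Rightarrow> nat set" where
  "fv (Eql t u) = tfv t \<union> tfv u"
| "fv (PAtom t u) = tfv t \<union> tfv u"
| "fv (NAtom t) = tfv t"
| "fv (Neg A) = fv A"
| "fv (Conj A B) = fv A \<union> fv B"
| "fv (Disj A B) = fv A \<union> fv B"
| "fv (Imp A B) = fv A \<union> fv B"
| "fv (All A) = {x. Suc x \<in> fv A}"
| "fv (Ex A) = {x. Suc x \<in> fv A}"

definition fvs :: "fm fset \<Rightarrow> nat set" where
  "fvs \<Gamma> = (\<Union>A\<in>fset \<Gamma>. fv A)"


section \<open>Sequents and the rules common to both systems\<close>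

datatype sequent = Sequent (ante: "fm fset") (succd: "fm fset")  (infix "\<turnstile>" 40)

inductive axiom_sequent :: "sequent \<Rightarrow> bool" where
  Ax: "\<Gamma> |\<inter>| \<Delta> \<noteq> {||} \<Longrightarrow> axiom_sequent (\<Gamma> \<turnstile> \<Delta>)"
| EqR: "axiom_sequent (\<Gamma> \<turnstile> finsert (Eql t t) \<Delta>)"
| NR0: "axiom_sequent (\<Gamma> \<turnstile> finsert (NAtom Zero) \<Delta>)"

text \<open>
  Rule instances carry the data that the definition of traces refers to.  The traces treat all
  rules other than substitution, equality-left and case-split alike, so these share the label
  \<open>Other\<close>.
\<close>

datatype rule_label =
    Substitution "nat \<Rightarrow> tm"
  | EqualityL nat tm nat tm
  | CaseSplit tm nat
  | Other

text \<open>
  \<open>common_rule r Ss S\<close>: the sequent \<open>S\<close> follows from the list of premises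
  \<open>Ss\<close>.  In \<open>EqL\<close> the variables \<open>x\<close> and \<open>y\<close> are substituted
  simultaneously.
\<close>

inductive common_rule :: "rule_label \<Rightarrow> sequent list \<Rightarrow> sequent \<Rightarrow> bool" where
  Weak: "\<Gamma>' |\<subseteq>| \<Gamma> \<Longrightarrow> \<Delta>' |\<subseteq>| \<Delta> \<Longrightarrow> common_rule Other [\<Gamma>' \<turnstile> \<Delta>'] (\<Gamma> \<turnstile> \<Delta>)"
| Cut: "common_rule Other [\<Gamma> \<turnstile> finsert A \<Delta>, finsert A \<Gamma> \<turnstile> \<Delta>] (\<Gamma> \<turnstile> \<Delta>)"
| Sub: "common_rule (Substitution \<theta>) [\<Gamma> \<turnstile> \<Delta>] (subst \<theta> |`| \<Gamma> \<turnstile> subst \<theta> |`| \<Delta>)"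
| NegL: "common_rule Other [\<Gamma> \<turnstile> finsert A \<Delta>] (finsert (Neg A) \<Gamma> \<turnstile> \<Delta>)"
| NegR: "common_rule Other [finsert A \<Gamma> \<turnstile> \<Delta>] (\<Gamma> \<turnstile> finsert (Neg A) \<Delta>)"
| ConjL: "common_rule Other [finsert A (finsert B \<Gamma>) \<turnstile> \<Delta>] (finsert (Conj A B) \<Gamma> \<turnstile> \<Delta>)"
| ConjR: "common_rule Other [\<Gamma> \<turnstile> finsert A \<Delta>, \<Gamma> \<turnstile> finsert B \<Delta>] (\<Gamma> \<turnstile> finsert (Conj A B) \<Delta>)"
| DisjL: "common_rule Other [finsert A \<Gamma> \<turnstile> \<Delta>, finsert B \<Gamma> \<turnstile> \<Delta>] (finsert (Disj A B) \<Gamma> \<turnstile> \<Delta>)"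
| DisjR: "common_rule Other [\<Gamma> \<turnstile> finsert A (finsert B \<Delta>)] (\<Gamma> \<turnstile> finsert (Disj A B) \<Delta>)"
| ImpL: "common_rule Other [\<Gamma> \<turnstile> finsert A \<Delta>, finsert B \<Gamma> \<turnstile> \<Delta>] (finsert (Imp A B) \<Gamma> \<turnstile> \<Delta>)"
| ImpR: "common_rule Other [finsert A \<Gamma> \<turnstile> finsert B \<Delta>] (\<Gamma> \<turnstile> finsert (Imp A B) \<Delta>)"
| AllL: "common_rule Other [finsert (inst A t) \<Gamma> \<turnstile> \<Delta>] (finsert (All A) \<Gamma> \<turnstile> \<Delta>)"
| AllR: "x \<notin> fvs \<Gamma> \<union> fvs \<Delta> \<union> fv (All A) \<Longrightarrow>
    common_rule Other [\<Gamma> \<turnstile> finsert (inst A (Var x)) \<Delta>] (\<Gamma> \<turnstile> finsert (All A) \<Delta>)"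
| ExL: "x \<notin> fvs \<Gamma> \<union> fvs \<Delta> \<union> fv (Ex A) \<Longrightarrow>
    common_rule Other [finsert (inst A (Var x)) \<Gamma> \<turnstile> \<Delta>] (finsert (Ex A) \<Gamma> \<turnstile> \<Delta>)"
| ExR: "common_rule Other [\<Gamma> \<turnstile> finsert (inst A t) \<Delta>] (\<Gamma> \<turnstile> finsert (Ex A) \<Delta>)"
| EqL: "x \<noteq> y \<Longrightarrow>
    common_rule (EqualityL x t y u)
      [subst (Var(x := u, y := t)) |`| \<Gamma> \<turnstile> subst (Var(x := u, y := t)) |`| \<Delta>]
      (finsert (Eql t u) (subst (Var(x := t, y := u)) |`| \<Gamma>)
        \<turnstile> subst (Var(x := t, y := u)) |`| \<Delta>)"
| NRs: "common_rule Other [\<Gamma> \<turnstile> finsert (NAtom t) \<Delta>] (\<Gamma> \<turnstile> finsert (NAtom (Sc t)) \<Delta>)"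


section \<open>LKID\<close>

text \<open>
  The induction formula \<open>F\<close> has its induction variable at index 0, like the body of a
  quantified formula; the free variables of \<open>F\<close> other than this one are
  \<^term>\<open>fv (All F)\<close>.
\<close>

inductive ind_rule :: "sequent list \<Rightarrow> sequent \<Rightarrow> bool" where
  "x \<notin> fvs \<Gamma> \<union> fvs \<Delta> \<union> fv (All F) \<union> tfv t \<Longrightarrow>
    ind_rule
      [\<Gamma> \<turnstile> finsert (inst F Zero) \<Delta>,
       finsert (inst F (Var x)) \<Gamma> \<turnstile> finsert (inst F (Sc (Var x))) \<Delta>,
       finsert (inst F t) \<Gamma> \<turnstile> \<Delta>]
      (finsert (NAtom t) \<Gamma> \<turnstile> \<Delta>)"

text \<open>Provability in LKID extended by a set \<open>T\<close> of non-logical axioms.\<close>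

inductive LKID :: "fm set \<Rightarrow> sequent \<Rightarrow> bool" for T :: "fm set" where
  "axiom_sequent S \<Longrightarrow> LKID T S"
| "A \<in> T \<Longrightarrow> LKID T ({||} \<turnstile> {|A|})"
| "common_rule r Ss S \<Longrightarrow> \<forall>S'\<in>set Ss. LKID T S' \<Longrightarrow> LKID T S"
| "ind_rule Ss S \<Longrightarrow> \<forall>S'\<in>set Ss. LKID T S' \<Longrightarrow> LKID T S"


section \<open>Cyclic proofs\<close>

inductive CLKID_rule :: "rule_label \<Rightarrow> sequent list \<Rightarrow> sequent \<Rightarrow> bool" where
  "common_rule r Ss S \<Longrightarrow> CLKID_rule r Ss S"
| "x \<notin> fvs \<Gamma> \<union> fvs \<Delta> \<union> fv (NAtom t) \<Longrightarrow>
    CLKID_rule (CaseSplit t x)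
      [finsert (Eql t Zero) \<Gamma> \<turnstile> \<Delta>,
       finsert (Eql t (Sc (Var x))) (finsert (NAtom (Var x)) \<Gamma>) \<turnstile> \<Delta>]
      (finsert (NAtom t) \<Gamma> \<turnstile> \<Delta>)"

datatype dtree = Leaf sequent | Inner sequent rule_label "dtree list"

primrec root_seq :: "dtree \<Rightarrow> sequent" where
  "root_seq (Leaf S) = S"
| "root_seq (Inner S r ds) = S"

text \<open>
  Every rule has at least one premise, so \<open>Inner\<close> nodes of a derivation tree are inner
  nodes indeed.
\<close>

fun derivation :: "dtree \<Rightarrow> bool" where
  "derivation (Leaf S) \<longleftrightarrow> True"
| "derivation (Inner S r ds) \<longleftrightarrow> CLKID_rule r (map root_seq ds) S \<and> (\<forall>d\<in>set ds. derivation d)"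

text \<open>Nodes of a tree are addressed by the list of child numbers leading to them.\<close>

type_synonym pos = "nat list"

fun subtree_at :: "dtree \<Rightarrow> pos \<Rightarrow> dtree option" where
  "subtree_at d [] = Some d"
| "subtree_at (Leaf S) (i # q) = None"
| "subtree_at (Inner S r ds) (i # q) = (if i < length ds then subtree_at (ds ! i) q else None)"

definition bud :: "dtree \<Rightarrow> pos \<Rightarrow> sequent \<Rightarrow> bool" where
  "bud d q S \<longleftrightarrow> subtree_at d q = Some (Leaf S) \<and> \<not> axiom_sequent S"

definition cyclic_preproof :: "dtree \<Rightarrow> (pos \<Rightarrow> pos) \<Rightarrow> bool" where
  "cyclic_preproof d c \<longleftrightarrow> derivation d \<and>
    (\<forall>q S. bud d q S \<longrightarrow> (\<exists>r ds. subtree_at d (c q) = Some (Inner S r ds)))"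

codatatype utree =
  UNode (useq: sequent) (urule: "rule_label option") (uchildren: "utree list")

text \<open>
  The unfolding of a pre-proof, starting at the node \<open>q\<close>: a bud is replaced by its
  companion, and axiom leaves have no rule label and no children.
\<close>

definition resolve :: "dtree \<Rightarrow> (pos \<Rightarrow> pos) \<Rightarrow> pos \<Rightarrow> pos" where
  "resolve d c q = (if \<exists>S. bud d q S then c q else q)"

primrec node_rule :: "dtree \<Rightarrow> rule_label option" where
  "node_rule (Leaf S) = None"
| "node_rule (Inner S r ds) = Some r"

primrec node_children :: "dtree \<Rightarrow> dtree list" where
  "node_children (Leaf S) = []"
| "node_children (Inner S r ds) = ds"

primcorec unfolding_from :: "dtree \<Rightarrow> (pos \<Rightarrow> pos) \<Rightarrow> pos \<Rightarrow> utree" where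
  "useq (unfolding_from d c q) = root_seq (the (subtree_at d (resolve d c q)))"
| "urule (unfolding_from d c q) = node_rule (the (subtree_at d (resolve d c q)))"
| "uchildren (unfolding_from d c q) =
    map (\<lambda>i. unfolding_from d c (resolve d c q @ [i]))
      [0..<length (node_children (the (subtree_at d (resolve d c q))))]"

definition infinite_path :: "utree \<Rightarrow> (nat \<Rightarrow> utree) \<Rightarrow> bool" where
  "infinite_path U \<pi> \<longleftrightarrow> \<pi> 0 = U \<and> (\<forall>i. \<pi> (Suc i) \<in> set (uchildren (\<pi> i)))"

text \<open>
  \<open>trace_step r A B\<close>: at a node whose rule is \<open>r\<close> a trace may pass from
  \<open>A\<close> in the conclusion to \<open>B\<close> in a premise.
\<close>

fun trace_step :: "rule_label \<Rightarrow> fm \<Rightarrow> fm \<Rightarrow> bool" where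
  "trace_step (Substitution \<theta>) A B \<longleftrightarrow> A = subst \<theta> B"
| "trace_step (EqualityL x t y u) A B \<longleftrightarrow>
    (\<exists>F. A = subst (Var(x := t, y := u)) F \<and> B = subst (Var(x := u, y := t)) F)"
| "trace_step (CaseSplit t x) A B \<longleftrightarrow> B = A \<or> (A = NAtom t \<and> B = NAtom (Var x))"
| "trace_step Other A B \<longleftrightarrow> B = A"

definition is_trace :: "(nat \<Rightarrow> utree) \<Rightarrow> (nat \<Rightarrow> fm) \<Rightarrow> bool" where
  "is_trace \<pi> \<tau> \<longleftrightarrow>
    (\<forall>i. \<tau> i |\<in>| ante (useq (\<pi> i)) \<and> (\<exists>t. \<tau> i = NAtom t) \<and>
      (\<exists>r. urule (\<pi> i) = Some r \<and> trace_step r (\<tau> i) (\<tau> (Suc i))))"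

definition progress_point :: "(nat \<Rightarrow> utree) \<Rightarrow> (nat \<Rightarrow> fm) \<Rightarrow> nat \<Rightarrow> bool" where
  "progress_point \<pi> \<tau> i \<longleftrightarrow>
    (\<exists>t x. urule (\<pi> i) = Some (CaseSplit t x) \<and>
      \<tau> i = NAtom t \<and> \<tau> (Suc i) = NAtom (Var x))"

definition global_trace_condition :: "utree \<Rightarrow> bool" where
  "global_trace_condition U \<longleftrightarrow>
    (\<forall>\<pi>. infinite_path U \<pi> \<longrightarrow>
      (\<exists>k \<tau>. is_trace (\<lambda>i. \<pi> (k + i)) \<tau> \<and>
        infinite {i. progress_point (\<lambda>i. \<pi> (k + i)) \<tau> i}))"

definition cyclic_proof :: "dtree \<Rightarrow> (pos \<Rightarrow> pos) \<Rightarrow> bool" where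
  "cyclic_proof d c \<longleftrightarrow>
    cyclic_preproof d c \<and> global_trace_condition (unfolding_from d c [])"

definition CLKID_omega :: "sequent \<Rightarrow> bool" where
  "CLKID_omega S \<longleftrightarrow> (\<exists>d c. cyclic_proof d c \<and> root_seq d = S)"


section \<open>The 2-Hydra formula and the (0,s)-axioms\<close>

definition AllN :: "fm \<Rightarrow> fm" where
  "AllN A = All (Imp (NAtom (Var 0)) A)"

abbreviation one :: tm where "one \<equiv> Sc Zero"

text \<open>
  Below a single quantifier \<^term>\<open>Var 0\<close> is the bound variable; below two,
  \<^term>\<open>Var 1\<close> is the outer one (\<open>x\<close>) and \<^term>\<open>Var 0\<close> the
  inner one (\<open>y\<close>).
\<close>

definition hydra_a :: fm where
  "hydra_a = AllN (Conj (PAtom Zero Zero) (Conj (PAtom one Zero) (PAtom (Var 0) one)))"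

definition hydra_b :: fm where
  "hydra_b = AllN (AllN (Imp (PAtom (Var 1) (Var 0)) (PAtom (Sc (Var 1)) (Sc (Sc (Var 0))))))"

definition hydra_c :: fm where
  "hydra_c = AllN (Imp (PAtom (Sc (Var 0)) (Var 0)) (PAtom Zero (Sc (Sc (Var 0)))))"

definition hydra_d :: fm where
  "hydra_d = AllN (Imp (PAtom (Sc (Var 0)) (Var 0)) (PAtom (Sc (Sc (Var 0))) Zero))"

definition hydra :: fm where
  "hydra = Imp (Conj hydra_a (Conj hydra_b (Conj hydra_c hydra_d)))
    (AllN (AllN (PAtom (Var 1) (Var 0))))"

definition zero_s_axioms :: "fm set" where
  "zero_s_axioms =
    {All (Imp (NAtom (Var 0)) (Neg (Eql (Sc (Var 0)) Zero))),
     All (All (Imp (Conj (NAtom (Var 1)) (NAtom (Var 0)))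
       (Imp (Eql (Sc (Var 1)) (Sc (Var 0))) (Eql (Var 1) (Var 0)))))}"

end

theory Submission
  imports Defs "HOL-Library.Infinite_Set"
begin

text \<open>
  For unprovability, take the structure with domain N + Z, successor acting on both summands and
  \<open>N\<close> true everywhere, and let \<open>p\<close> be the complement of the graph of a function \<open>dbl\<close> that
  doubles but exchanges N with the nonnegative half of Z.  Then \<open>H\<close> fails: starting from a point of
  the graph, the hydra never dies.  Still every definable set
  agrees, up to finitely many points, with a union of residue classes modulo some power of 2
  (by a back-and-forth argument: away from 0 and the origin of Z, successor and \<open>dbl\<close> act as the
  affine maps \<open>x + 1\<close> and \<open>2 x\<close>).  A definable set containing 0 and closed under successor is
  therefore cofinite, and as its complement is closed under predecessor, it is everything.  So the
  structure satisfies the induction rule.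

  For cyclic provability, split \<open>x\<close> and \<open>y\<close> into cases; with \<open>x = s x'\<close>, \<open>x' = s x''\<close>,
  \<open>y = s y'\<close>, \<open>y' = s y''\<close>, the three
  recursive cases cut on \<open>p(x', y'')\<close>, \<open>p(y', y'')\<close> and \<open>p(x', x'')\<close>, respectively, and loop back.
  In the first loop \<open>x\<close> and \<open>y\<close> each trace back to themselves, in the second both trace back to
  \<open>y\<close>, in the third both to \<open>x\<close>; always with progress.  Hence a trace can be chosen by looking
  ahead to the next loop of the second or third kind.
\<close>

section \<open>A structure on N + Z\<close>

datatype point = Std nat | NonStd int

fun val :: "point \<Rightarrow> int" where
  "val (Std n) = int n"
| "val (NonStd z) = z"

text \<open>
  The three ends of the domain: those of \<open>Std\<close> and of the two halves of \<open>NonStd\<close>.  The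
  values are chosen so that \<open>dbl\<close> negates \<open>side\<close>.
\<close>

fun side :: "point \<Rightarrow> int" where
  "side (Std n) = 1"
| "side (NonStd z) = (if z < 0 then 0 else -1)"

fun suc :: "point \<Rightarrow> point" where
  "suc (Std n) = Std (Suc n)"
| "suc (NonStd z) = NonStd (z + 1)"

fun dbl :: "point \<Rightarrow> point" where
  "dbl (Std n) = NonStd (2 * int n)"
| "dbl (NonStd z) = (if z < 0 then NonStd (2 * z) else Std (nat (2 * z)))"

lemma point_eqI: "val x = val y \<Longrightarrow> side x = side y \<Longrightarrow> x = y"
  by (cases x; cases y) (auto split: if_splits)

lemma point_eq_iff: "x = y \<longleftrightarrow> val x = val y \<and> side x = side y"
  using point_eqI by blast

lemma side_cases: "val x < 0 \<and> side x = 0 \<or> 0 \<le> val x \<and> (side x = 1 \<or> side x = -1)"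
  by (cases x) auto

text \<open>With \<open>point_eqI\<close> and \<open>side_cases\<close> this makes points the same
  as admissible pairs of value and side, so a witness can be found by prescribing both.\<close>

lemma ex_point:
  assumes "v < 0 \<and> s = 0 \<or> 0 \<le> v \<and> (s = 1 \<or> s = -1)"
  shows "\<exists>x. val x = v \<and> side x = s"
proof -
  have "val (NonStd v) = v \<and> side (NonStd v) = s" if "s \<noteq> 1"
    using assms that by auto
  moreover have "val (Std (nat v)) = v \<and> side (Std (nat v)) = s" if "s = 1"
    using assms that by auto
  ultimately show ?thesis by blast
qed

lemma val_dbl: "val (dbl x) = 2 * val x"
  by (cases x) auto

lemma side_dbl: "side (dbl x) = - side x"
  by (cases x) auto

lemma val_suc: "val (suc x) = val x + 1"
  by (cases x) auto

lemma suc_inject: "suc x = suc y \<Longrightarrow> x = y"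
  by (cases x; cases y) auto

lemma suc_neq_zero: "suc x \<noteq> Std 0"
  by (cases x) auto

lemma val_suc_iter: "val ((suc ^^ k) x) = val x + int k"
  by (induction k) (auto simp: val_suc)

text \<open>The side changes only when a negative nonstandard point reaches the origin, which takes
  at least |val x| steps.\<close>

lemma side_suc_iter: "int k < \<bar>val x\<bar> \<Longrightarrow> side ((suc ^^ k) x) = side x"
proof -
  have "(suc ^^ k) (Std n) = Std (n + k)" "(suc ^^ k) (NonStd z) = NonStd (z + int k)" for n z
    by (induction k) auto
  then show "int k < \<bar>val x\<bar> \<Longrightarrow> ?thesis" by (cases x) auto
qed

section \<open>Satisfaction\<close>

primrec teval :: "(nat \<Rightarrow> point) \<Rightarrow> tm \<Rightarrow> point" where
  "teval e (Var x) = e x"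
| "teval e Zero = Std 0"
| "teval e (Sc t) = suc (teval e t)"

primrec sat :: "(nat \<Rightarrow> point) \<Rightarrow> fm \<Rightarrow> bool" where
  "sat e (Eql t u) \<longleftrightarrow> teval e t = teval e u"
| "sat e (PAtom t u) \<longleftrightarrow> teval e u \<noteq> dbl (teval e t)"
| "sat e (NAtom t) \<longleftrightarrow> True"
| "sat e (Neg A) \<longleftrightarrow> \<not> sat e A"
| "sat e (Conj A B) \<longleftrightarrow> sat e A \<and> sat e B"
| "sat e (Disj A B) \<longleftrightarrow> sat e A \<or> sat e B"
| "sat e (Imp A B) \<longleftrightarrow> (sat e A \<longrightarrow> sat e B)"
| "sat e (All A) \<longleftrightarrow> (\<forall>x. sat (case_nat x e) A)"
| "sat e (Ex A) \<longleftrightarrow> (\<exists>x. sat (case_nat x e) A)"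

lemma teval_cong: "(\<And>x. x \<in> tfv t \<Longrightarrow> e x = e' x) \<Longrightarrow> teval e t = teval e' t"
  by (induction t) auto

lemma sat_cong: "(\<And>x. x \<in> fv A \<Longrightarrow> e x = e' x) \<Longrightarrow> sat e A \<longleftrightarrow> sat e' A"
proof (induction A arbitrary: e e')
  case (All A)
  have "sat (case_nat x e) A = sat (case_nat x e') A" for x
    using All.prems by (intro All.IH) (auto split: nat.split)
  then show ?case by simp
next
  case (Ex A)
  have "sat (case_nat x e) A = sat (case_nat x e') A" for x
    using Ex.prems by (intro Ex.IH) (auto split: nat.split)
  then show ?case by simp
next
  case (Eql t u)
  then have "teval e t = teval e' t" "teval e u = teval e' u" by (auto intro!: teval_cong)
  then show ?case by simp
next
  case (PAtom t u)
  then have "teval e t = teval e' t" "teval e u = teval e' u" by (auto intro!: teval_cong)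
  then show ?case by simp
next
  case (Conj A B)
  have "sat e A = sat e' A" "sat e B = sat e' B"
    by (intro Conj.IH Conj.prems; simp)+
  then show ?case by simp
next
  case (Disj A B)
  have "sat e A = sat e' A" "sat e B = sat e' B"
    by (intro Disj.IH Disj.prems; simp)+
  then show ?case by simp
next
  case (Imp A B)
  have "sat e A = sat e' A" "sat e B = sat e' B"
    by (intro Imp.IH Imp.prems; simp)+
  then show ?case by simp
next
  case (Neg A)
  have "sat e A = sat e' A" by (intro Neg.IH Neg.prems; simp)
  then show ?case by simp
qed auto

lemma teval_tsubst: "teval e (tsubst \<theta> t) = teval (\<lambda>n. teval e (\<theta> n)) t"
  by (induction t) auto

lemma teval_lift: "(\<lambda>n. teval (case_nat x e) (lift \<theta> n)) = case_nat x (\<lambda>n. teval e (\<theta> n))"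
  by (auto simp: lift_def teval_tsubst split: nat.split)

lemma sat_subst: "sat e (subst \<theta> A) \<longleftrightarrow> sat (\<lambda>n. teval e (\<theta> n)) A"
  by (induction A arbitrary: e \<theta>) (auto simp: teval_tsubst teval_lift)

lemma sat_inst: "sat e (inst A t) \<longleftrightarrow> sat (case_nat (teval e t) e) A"
proof -
  have "(\<lambda>n. teval e (case n of 0 \<Rightarrow> t | Suc m \<Rightarrow> Var m)) = case_nat (teval e t) e"
    by (auto split: nat.split)
  then show ?thesis by (simp add: inst_def sat_subst)
qed

section \<open>Back and forth\<close>

text \<open>
  Far from 0 and from the origin of \<open>NonStd\<close>, this says that
  \<open>dbl\<^sup>a x\<close> shifted by \<open>c\<close> is \<open>dbl\<^sup>b y\<close>.
\<close>

definition linked :: "nat \<Rightarrow> nat \<Rightarrow> int \<Rightarrow> point \<Rightarrow> point \<Rightarrow> bool" where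
  "linked a b c x y \<longleftrightarrow>
    2 ^ a * val x + c = 2 ^ b * val y \<and> (-1) ^ a * side x = (-1) ^ b * side y"

text \<open>The rank-R type of an n-tuple in the back-and-forth game. Congruence modulo a power of 2
  is included because a link that can be solved for a new point over one tuple must be solvable over
  the other.\<close>

definition agree :: "nat \<Rightarrow> nat \<Rightarrow> (nat \<Rightarrow> point) \<Rightarrow> (nat \<Rightarrow> point) \<Rightarrow> bool" where
  "agree R n e e' \<longleftrightarrow> (\<forall>i<n.
    2 ^ R dvd val (e i) - val (e' i) \<and>
    (\<bar>val (e i)\<bar> \<le> int R \<or> \<bar>val (e' i)\<bar> \<le> int R \<longrightarrow> e i = e' i) \<and>
    (\<forall>j<n. \<forall>a\<le>R. \<forall>b\<le>R. \<forall>c. \<bar>c\<bar> \<le> int R \<longrightarrow>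
      linked a b c (e i) (e j) = linked a b c (e' i) (e' j)))"

lemma agree_dvd: "agree R n e e' \<Longrightarrow> i < n \<Longrightarrow> 2 ^ R dvd val (e i) - val (e' i)"
  unfolding agree_def by blast

lemma agree_small:
  "agree R n e e' \<Longrightarrow> i < n \<Longrightarrow> \<bar>val (e i)\<bar> \<le> int R \<or> \<bar>val (e' i)\<bar> \<le> int R \<Longrightarrow> e i = e' i"
  unfolding agree_def by blast

lemma agree_linked:
  "agree R n e e' \<Longrightarrow> i < n \<Longrightarrow> j < n \<Longrightarrow> a \<le> R \<Longrightarrow> b \<le> R \<Longrightarrow> \<bar>c\<bar> \<le> int R \<Longrightarrow>
    linked a b c (e i) (e j) = linked a b c (e' i) (e' j)"
  unfolding agree_def by blast

lemma agree_sym: "agree R n e e' \<Longrightarrow> agree R n e' e"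
  unfolding agree_def by (metis dvd_diff_commute)

lemma agree_mono:
  assumes "agree S n e e'" "R \<le> S" shows "agree R n e e'"
proof -
  have "2 ^ R dvd val (e i) - val (e' i)" if "i < n" for i
    using agree_dvd[OF assms(1) that] le_imp_power_dvd[OF assms(2), of "2::int"] dvd_trans by blast
  moreover have "e i = e' i" if "i < n" "\<bar>val (e i)\<bar> \<le> int R \<or> \<bar>val (e' i)\<bar> \<le> int R" for i
    using agree_small[OF assms(1) that(1)] that(2) assms(2) by linarith
  moreover have "linked a b c (e i) (e j) = linked a b c (e' i) (e' j)"
    if "i < n" "j < n" "a \<le> R" "b \<le> R" "\<bar>c\<bar> \<le> int R" for i j a b c
    using that assms(2) by (intro agree_linked[OF assms(1)]) auto
  ultimately show ?thesis unfolding agree_def by blast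
qed

lemma linked_sym: "linked a b c x y \<longleftrightarrow> linked b a (- c) y x"
  by (auto simp: linked_def)

text \<open>A link of x to itself says c = (2^b - 2^a) * val x, and for distinct a and b the right
  side is at least |val x| in absolute value.\<close>

lemma linked_self:
  assumes "\<bar>c\<bar> \<le> int R" "int R < \<bar>val x\<bar>"
  shows "linked a b c x x \<longleftrightarrow> a = b \<and> c = 0"
proof
  assume "linked a b c x x"
  then have c: "c = (2 ^ b - 2 ^ a) * val x" by (simp add: linked_def algebra_simps)
  have "(2::int) ^ b - 2 ^ a = 0"
  proof (rule ccontr)
    assume "(2::int) ^ b - 2 ^ a \<noteq> 0"
    then have "1 \<le> \<bar>(2::int) ^ b - 2 ^ a\<bar>" by linarith
    then have "1 * \<bar>val x\<bar> \<le> \<bar>(2::int) ^ b - 2 ^ a\<bar> * \<bar>val x\<bar>" by (intro mult_right_mono) auto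
    then show False using assms c by (simp add: abs_mult)
  qed
  then show "a = b \<and> c = 0" using c by simp
qed (simp add: linked_def)

text \<open>Among the links, only those from the new point to old ones have to be matched:
  \<open>linked_self\<close> settles the links of the new point to itself, \<open>linked_sym\<close>
  the reversed ones.\<close>

lemma agree_extend:
  assumes "agree R n e e'"
    and "2 ^ R dvd val x - val x'"
    and "\<bar>val x\<bar> \<le> int R \<or> \<bar>val x'\<bar> \<le> int R \<longrightarrow> x = x'"
    and l: "\<And>a b c j. a \<le> R \<Longrightarrow> b \<le> R \<Longrightarrow> \<bar>c\<bar> \<le> int R \<Longrightarrow> j < n \<Longrightarrow>
      linked a b c x (e j) = linked a b c x' (e' j)"
  shows "agree R (Suc n) (case_nat x e) (case_nat x' e')"
proof -
  have self: "linked a b c x x = linked a b c x' x'" if "\<bar>c\<bar> \<le> int R" for a b c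
  proof (cases "\<bar>val x\<bar> \<le> int R \<or> \<bar>val x'\<bar> \<le> int R")
    case True
    then show ?thesis using assms(3) by simp
  next
    case False
    then show ?thesis using linked_self[OF that] by simp
  qed
  have l': "linked a b c (e j) x = linked a b c (e' j) x'"
    if "a \<le> R" "b \<le> R" "\<bar>c\<bar> \<le> int R" "j < n" for a b c j
    using l[of b a "-c" j] that linked_sym[of a b c "e j" x] linked_sym[of a b c "e' j" x'] by simp
  show ?thesis
    unfolding agree_def
  proof (intro allI impI conjI)
    fix i assume i: "i < Suc n"
    show "2 ^ R dvd val (case_nat x e i) - val (case_nat x' e' i)"
      using i assms(2) agree_dvd[OF assms(1)] by (cases i) simp_all
    assume "\<bar>val (case_nat x e i)\<bar> \<le> int R \<or> \<bar>val (case_nat x' e' i)\<bar> \<le> int R"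
    then show "case_nat x e i = case_nat x' e' i"
      using i assms(3) agree_small[OF assms(1)] by (cases i) simp_all
  next
    fix i j a b c assume "i < Suc n" "j < Suc n" "a \<le> R" "b \<le> R" "\<bar>c\<bar> \<le> int R"
    then show "linked a b c (case_nat x e i) (case_nat x e j) =
        linked a b c (case_nat x' e' i) (case_nat x' e' j)"
      using self l l' agree_linked[OF assms(1)] by (cases i; cases j) simp_all
  qed
qed

lemma abs_le_abs_power_mult: "\<bar>v\<bar> \<le> \<bar>2 ^ a * (v::int)\<bar>"
proof -
  have "1 * \<bar>v\<bar> \<le> 2 ^ a * \<bar>v\<bar>" by (intro mult_right_mono) auto
  then show ?thesis by (simp add: abs_mult)
qed

lemma abs_power_mult_le:
  assumes "a \<le> R" "\<bar>v\<bar> \<le> T" shows "\<bar>2 ^ a * (v::int)\<bar> \<le> 2 ^ R * T"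
proof -
  have "(2::int) ^ a * \<bar>v\<bar> \<le> 2 ^ R * T" using assms by (intro mult_mono power_increasing) auto
  then show ?thesis by (simp add: abs_mult)
qed

text \<open>|val x| is at most |2^a * val x| = |2^b * val y - c|. This estimate dictates the growth
  of ranks in \<open>gap\<close>.\<close>

lemma linked_bound:
  assumes "linked a b c x y" "b \<le> R" "\<bar>c\<bar> \<le> int R" "\<bar>val y\<bar> \<le> T"
  shows "\<bar>val x\<bar> \<le> 2 ^ R * T + int R"
  using abs_le_abs_power_mult[of "val x" a] abs_power_mult_le[OF assms(2,4)] assms(1,3)
  unfolding linked_def by linarith

definition spread :: "nat \<Rightarrow> nat \<Rightarrow> (nat \<Rightarrow> point) \<Rightarrow> int" where
  "spread R n e = 2 ^ R * (\<Sum>i<n. \<bar>val (e i)\<bar>) + int R"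

lemma not_linked_spread:
  assumes "spread R n e < \<bar>val x\<bar>" "b \<le> R" "\<bar>c\<bar> \<le> int R" "j < n"
  shows "\<not> linked a b c x (e j)"
proof
  assume "linked a b c x (e j)"
  moreover have "\<bar>val (e j)\<bar> \<le> (\<Sum>i<n. \<bar>val (e i)\<bar>)"
    using assms(4) by (intro member_le_sum) auto
  ultimately have "\<bar>val x\<bar> \<le> spread R n e"
    unfolding spread_def using linked_bound assms(2,3) by blast
  then show False using assms(1) by simp
qed

lemma spread_ge: "int R \<le> spread R n e"
  by (simp add: spread_def sum_nonneg)

text \<open>A large point without links to the tuple has no rank-R feature but its residue modulo
  2^R. A standard number far beyond the tuple with this residue looks the same. That the witness is
  standard is what the induction argument exploits.\<close>

lemma agree_generic:
  assumes ag: "agree R n e e'" and big: "int R < \<bar>val x\<bar>"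
    and nl: "\<And>a b c j. a \<le> R \<Longrightarrow> b \<le> R \<Longrightarrow> \<bar>c\<bar> \<le> int R \<Longrightarrow> j < n \<Longrightarrow> \<not> linked a b c x (e j)"
  shows "\<exists>m. agree R (Suc n) (case_nat x e) (case_nat (Std m) e')"
proof -
  define B where "B = spread R n e' + 1"
  \<comment> \<open>The residue of \<open>val x\<close>, pushed beyond the spread of
    \<open>e'\<close> by a multiple of 2^R.\<close>
  define v where "v = val x mod 2 ^ R + B * 2 ^ R"
  have B: "int R < B" using spread_ge[of R n e'] by (simp add: B_def)
  have "B * 1 \<le> B * 2 ^ R" using B by (intro mult_left_mono) auto
  moreover have "0 \<le> val x mod 2 ^ R" by simp
  ultimately have v: "B \<le> v" unfolding v_def by linarith
  have vm: "val (Std (nat v)) = v" using v B by simp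
  have "val x mod 2 ^ R = v mod 2 ^ R" by (simp add: v_def)
  then have "2 ^ R dvd val x - v" using mod_eq_dvd_iff by blast
  moreover have "\<not> linked a b c (Std (nat v)) (e' j)" if "b \<le> R" "\<bar>c\<bar> \<le> int R" "j < n" for a b c j
    using v vm that by (intro not_linked_spread) (auto simp: B_def)
  ultimately have "agree R (Suc n) (case_nat x e) (case_nat (Std (nat v)) e')"
    using nl big B v vm by (intro agree_extend[OF ag]) auto
  then show ?thesis ..
qed

lemma power_neg_one_cancel: "(-1 :: int) ^ a * s = (-1) ^ b * t \<longleftrightarrow> s = (-1) ^ (a + b) * t"
  by (cases "even a"; cases "even b") auto

text \<open>Multiply 2^p * val x + q = 2^r * val z by 2^a and replace 2^a * val x by 2^b * val y -
  c. Links of a new point become links of the old point it is tied to, at a higher rank.\<close>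

lemma linked_trans_iff:
  assumes "linked a b c x y"
  shows "linked p r q x z \<longleftrightarrow> linked (p + b) (r + a) (2 ^ a * q - 2 ^ p * c) y z"
proof -
  have v: "2 ^ a * val x = 2 ^ b * val y - c" and s: "side x = (-1) ^ (a + b) * side y"
    using assms by (auto simp: linked_def power_neg_one_cancel)
  have "2 ^ p * val x + q = 2 ^ r * val z \<longleftrightarrow> 2 ^ a * (2 ^ p * val x + q) = 2 ^ a * (2 ^ r * val z)"
    by simp
  also have "2 ^ a * (2 ^ p * val x + q) = 2 ^ p * (2 ^ a * val x) + 2 ^ a * q"
    by (simp add: algebra_simps)
  also have "\<dots> = 2 ^ (p + b) * val y + (2 ^ a * q - 2 ^ p * c)"
    unfolding v by (simp add: algebra_simps power_add)
  finally have 1: "2 ^ p * val x + q = 2 ^ r * val z \<longleftrightarrow>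
      2 ^ (p + b) * val y + (2 ^ a * q - 2 ^ p * c) = 2 ^ (r + a) * val z"
    by (simp add: power_add mult_ac)
  have 2: "(-1) ^ p * side x = (-1) ^ r * side z \<longleftrightarrow>
      (-1) ^ (p + b) * side y = (-1) ^ (r + a) * side z"
    by (cases "even a"; cases "even b"; cases "even p"; cases "even r") (auto simp: s)
  show ?thesis using 1 2 by (simp add: linked_def)
qed

text \<open>The bound of \<open>linked_bound\<close> for T = R.\<close>

definition gap :: "nat \<Rightarrow> nat" where
  "gap R = 2 ^ R * R + R"

text \<open>The forth move. A small x is answered by itself, an x linked to some entry by solving
  the same link over \<open>e'\<close>, and any other x by \<open>agree_generic\<close>.\<close>

lemma agree_ex_extend:
  assumes ag: "agree (gap (gap (gap R))) n e e'"
  shows "\<exists>x'. agree R (Suc n) (case_nat x e) (case_nat x' e')"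
proof -
  \<comment> \<open>Points within T are answered by themselves, and entries linked to them lie
    within S. Points beyond T are linked only to entries beyond U, and solving a link from an entry
    beyond U gives a point beyond R.\<close>
  define U where "U = gap R"
  define T where "T = gap U"
  define S where "S = gap T"
  have g: "r \<le> gap r" "2 * r \<le> gap r" for r
  proof -
    have "1 * r \<le> 2 ^ r * r" by (intro mult_right_mono) auto
    then show "r \<le> gap r" "2 * r \<le> gap r" by (auto simp: gap_def)
  qed
  have RS: "R \<le> U" "U \<le> T" "T \<le> S" "2 * R \<le> U" "R \<le> S" "2 * R \<le> S" "R \<le> T" "U \<le> S"
    using g(1)[of R] g(1)[of U] g(1)[of T] g(2)[of R] by (auto simp: U_def T_def S_def)
  have agS: "agree S n e e'" using ag by (simp add: S_def T_def U_def)
  have agR: "agree R n e e'" using agree_mono[OF agS RS(5)] .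
  have gapI: "2 ^ R * int r + int R \<le> int (gap r)" if "R \<le> r" for r
  proof -
    have "(2::int) ^ R * int r \<le> 2 ^ r * int r" using that by (intro mult_right_mono power_increasing) auto
    then show ?thesis using that by (simp add: gap_def)
  qed
  consider (small) "\<bar>val x\<bar> \<le> int T"
    | (near) a b c i where "int T < \<bar>val x\<bar>" "a \<le> R" "b \<le> R" "\<bar>c\<bar> \<le> int R" "i < n" "linked a b c x (e i)"
    | (far) "int T < \<bar>val x\<bar>"
        "\<And>a b c j. a \<le> R \<Longrightarrow> b \<le> R \<Longrightarrow> \<bar>c\<bar> \<le> int R \<Longrightarrow> j < n \<Longrightarrow> \<not> linked a b c x (e j)"
  proof (cases "\<bar>val x\<bar> \<le> int T")
    case False
    then show ?thesis
    proof (cases "\<exists>a\<le>R. \<exists>b\<le>R. \<exists>c i. \<bar>c\<bar> \<le> int R \<and> i < n \<and> linked a b c x (e i)")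
      case True
      then show ?thesis using near False by auto
    next
      case none: False
      show ?thesis by (rule far) (use False none in auto)
    qed
  qed (rule small)
  then show ?thesis
  proof cases
    case small
    have "linked a b c x (e j) = linked a b c x (e' j)"
      if h: "a \<le> R" "b \<le> R" "\<bar>c\<bar> \<le> int R" "j < n" for a b c j
    proof -
      have *: "e j = e' j" if l: "linked a b c x (e j) \<or> linked a b c x (e' j)"
      proof -
        have "\<bar>val y\<bar> \<le> int S" if "linked a b c x y" for y
          using linked_bound[of b a "-c" y x R "int T"] that h small linked_sym[of a b c x y]
            gapI[OF RS(7)] by (auto simp: S_def)
        then show ?thesis using l agree_small[OF agS h(4)] by blast
      qed
      show ?thesis
      proof (cases "linked a b c x (e j) \<or> linked a b c x (e' j)")
        case True
        then show ?thesis using * by simp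
      qed auto
    qed
    then have "agree R (Suc n) (case_nat x e) (case_nat x e')"
      using small by (intro agree_extend[OF agR]) auto
    then show ?thesis ..
  next
    case near
    have big: "int U < \<bar>val (e i)\<bar>"
    proof (rule ccontr)
      assume "\<not> int U < \<bar>val (e i)\<bar>"
      then have "\<bar>val x\<bar> \<le> 2 ^ R * int U + int R"
        using linked_bound[OF near(6,3,4), of "int U"] by simp
      then show False using gapI[OF RS(1)] near(1) by (simp add: T_def)
    qed
    have big': "int U < \<bar>val (e' i)\<bar>"
      using agree_small[OF agS near(5)] big RS(8) by fastforce
    \<comment> \<open>The new value v must satisfy 2^a * v = 2^b * val (e' i) - c. The right side is
      divisible by 2^a because this holds for \<open>e i\<close>, and the two entries are congruent
      modulo 2^S.\<close>
    have d: "2 ^ S dvd val (e i) - val (e' i)" using agree_dvd[OF agS near(5)] .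
    have eq: "2 ^ a * val x + c = 2 ^ b * val (e i)" using near(6) by (simp add: linked_def)
    have "(2::int) ^ a dvd 2 ^ S" using near(2) RS(5) by (intro le_imp_power_dvd) simp
    then have "2 ^ a dvd 2 ^ a * val x - 2 ^ b * (val (e i) - val (e' i))"
      by (intro dvd_diff dvd_triv_left dvd_mult dvd_trans[OF _ d])
    also have "\<dots> = 2 ^ b * val (e' i) - c" using eq by (simp add: algebra_simps)
    finally obtain v where v: "2 ^ b * val (e' i) - c = 2 ^ a * v" by (auto elim: dvdE)
    have U: "2 ^ R * int R + int R = int U" by (simp add: U_def gap_def)
    have vbig: "int R < \<bar>v\<bar>"
    proof (rule ccontr)
      assume "\<not> int R < \<bar>v\<bar>"
      then have "\<bar>2 ^ a * v\<bar> \<le> 2 ^ R * int R" using near(2) by (intro abs_power_mult_le) auto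
      then show False using abs_le_abs_power_mult[of "val (e' i)" b] v big' near(4) U by linarith
    qed
    \<comment> \<open>Both values are large compared with c, so they have the same sign; hence the
      side prescribed by the link is admissible for v.\<close>
    have sgn: "v < 0 \<longleftrightarrow> val (e' i) < 0"
    proof -
      have "v < 0 \<longleftrightarrow> 2 ^ a * v < 0" by (simp add: mult_less_0_iff)
      also have "\<dots> \<longleftrightarrow> 2 ^ b * val (e' i) < 0"
        using abs_le_abs_power_mult[of v a] abs_le_abs_power_mult[of "val (e' i)" b] v big' vbig near(4) RS(1)
        by linarith
      also have "\<dots> \<longleftrightarrow> val (e' i) < 0" by (simp add: mult_less_0_iff)
      finally show ?thesis .
    qed
    obtain x' where x': "val x' = v" "side x' = (-1) ^ (a + b) * side (e' i)"
    proof -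
      have "\<exists>x'. val x' = v \<and> side x' = (-1) ^ (a + b) * side (e' i)"
        using side_cases[of "e' i"] sgn by (intro ex_point) (cases "even (a + b)"; auto)
      then show ?thesis using that by blast
    qed
    have l': "linked a b c x' (e' i)"
      unfolding linked_def power_neg_one_cancel using x' v by simp
    have "agree R (Suc n) (case_nat x e) (case_nat x' e')"
    proof (rule agree_extend[OF agR])
      \<comment> \<open>Solving for x divides by 2^a, so the entries have to be congruent modulo
        2^(a + R).\<close>
      have "(2::int) ^ (a + R) dvd 2 ^ S" using near(2) RS(6) by (intro le_imp_power_dvd) simp
      then have "2 ^ (a + R) dvd 2 ^ b * (val (e i) - val (e' i))" using d by (meson dvd_mult dvd_trans)
      also have "\<dots> = 2 ^ a * (val x - val x')" using eq v x'(1) by (simp add: algebra_simps)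
      finally show "2 ^ R dvd val x - val x'" by (simp add: power_add)
      show "\<bar>val x\<bar> \<le> int R \<or> \<bar>val x'\<bar> \<le> int R \<longrightarrow> x = x'"
        using near(1) RS(7) vbig x'(1) by auto
    next
      fix p r q j assume h: "p \<le> R" "r \<le> R" "\<bar>q\<bar> \<le> int R" "j < n"
      \<comment> \<open>By \<open>linked_trans_iff\<close> the links of x and x' to entry j are
        links of the entries i to j, with exponents at most 2 R and a shift at most S.\<close>
      have "\<bar>2 ^ a * q - 2 ^ p * c\<bar> \<le> 2 * (2 ^ R * int R)"
        using abs_power_mult_le[OF near(2) h(3)] abs_power_mult_le[OF h(1) near(4)] by linarith
      also have "\<dots> \<le> int S"
      proof -
        have "2 * int U \<le> int T" using g(2)[of U] by (simp add: T_def)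
        then show ?thesis using U RS(3) by linarith
      qed
      finally show "linked p r q x (e j) = linked p r q x' (e' j)"
        unfolding linked_trans_iff[OF near(6)] linked_trans_iff[OF l']
        using h near RS(6) by (intro agree_linked[OF agS]) auto
    qed
    then show ?thesis ..
  next
    case far
    have "int R < \<bar>val x\<bar>" using far(1) RS(7) by linarith
    then show ?thesis using agree_generic[OF agR _ far(2)] by blast
  qed
qed


section \<open>Invariance of formulas under agreement of tuples\<close>

text \<open>If one of the values is at most k + l in absolute value, the equation forces both points
  within R, where x = x' and y = y'. Otherwise the successors do not change sides and the equation
  is a link with shift 2^a * k - l. The link hypothesis exempts \<open>Std 0\<close>, the value of
  \<open>Zero\<close>, because \<open>agree\<close> speaks about variables only.\<close>

lemma dbl_suc_iter_eq_iff:
  fixes a k l :: nat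
  defines "R \<equiv> 2 ^ a * (2 * k + l) + 2 * (k + l) + a"
  assumes x: "\<bar>val x\<bar> \<le> int R \<or> \<bar>val x'\<bar> \<le> int R \<Longrightarrow> x = x'"
    and y: "\<bar>val y\<bar> \<le> int R \<or> \<bar>val y'\<bar> \<le> int R \<Longrightarrow> y = y'"
    and l: "\<And>c. x \<noteq> Std 0 \<Longrightarrow> y \<noteq> Std 0 \<Longrightarrow> \<bar>c\<bar> \<le> int R \<Longrightarrow>
      linked a 0 c x y = linked a 0 c x' y'"
  shows "(dbl ^^ a) ((suc ^^ k) x) = (suc ^^ l) y \<longleftrightarrow> (dbl ^^ a) ((suc ^^ k) x') = (suc ^^ l) y'"
    (is "?P x y \<longleftrightarrow> ?P x' y'")
proof -
  define r where "r = int (k + l)"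
  have dbl: "val ((dbl ^^ a) z) = 2 ^ a * val z" "side ((dbl ^^ a) z) = (-1) ^ a * side z" for a z
    by (induction a) (auto simp: val_dbl side_dbl)
  have v: "2 ^ a * (val u + int k) = val w + int l" if "?P u w" for u w
    using arg_cong[OF that, of val] by (simp add: dbl val_suc_iter)
  have R: "int R = 2 ^ a * (2 * int k + int l) + 2 * (int k + int l) + int a"
    by (simp add: R_def)
  have R': "int R = 2 * (2 ^ a * int k) + 2 ^ a * int l + 2 * int k + 2 * int l + int a"
    by (simp add: R algebra_simps)
  have pk: "0 \<le> (2::int) ^ a * int k" "0 \<le> (2::int) ^ a * int l" by auto
  have rR: "r \<le> int R" "0 \<le> r" using pk by (auto simp: r_def R algebra_simps)
  have small: "\<bar>val u\<bar> \<le> int R \<and> \<bar>val w\<bar> \<le> int R" if "?P u w" "\<bar>val u\<bar> \<le> r \<or> \<bar>val w\<bar> \<le> r" for u w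
    using that(2)
  proof
    assume h: "\<bar>val u\<bar> \<le> r"
    then have "\<bar>2 ^ a * (val u + int k)\<bar> \<le> 2 ^ a * (r + int k)"
      by (intro abs_power_mult_le) auto
    then show ?thesis using v[OF that(1)] h pk rR by (auto simp: r_def R algebra_simps)
  next
    assume h: "\<bar>val w\<bar> \<le> r"
    have "\<bar>val u + int k\<bar> \<le> \<bar>2 ^ a * (val u + int k)\<bar>" by (rule abs_le_abs_power_mult)
    then show ?thesis using v[OF that(1)] h pk R' unfolding r_def by linarith
  qed
  have big: "?P u w \<longleftrightarrow> linked a 0 (2 ^ a * int k - int l) u w" if "r < \<bar>val u\<bar>" "r < \<bar>val w\<bar>" for u w
  proof -
    have "side ((suc ^^ k) u) = side u" "side ((suc ^^ l) w) = side w"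
      using that by (auto intro!: side_suc_iter simp: r_def)
    then show ?thesis
      by (auto simp: point_eq_iff[of "(dbl ^^ a) _"] dbl val_suc_iter linked_def algebra_simps)
  qed
  show ?thesis
  proof (cases "\<bar>val x\<bar> \<le> r \<or> \<bar>val y\<bar> \<le> r \<or> \<bar>val x'\<bar> \<le> r \<or> \<bar>val y'\<bar> \<le> r")
    case True
    then have "\<bar>val x\<bar> \<le> r \<or> \<bar>val y\<bar> \<le> r" "\<bar>val x'\<bar> \<le> r \<or> \<bar>val y'\<bar> \<le> r"
      using x y rR by fastforce+
    then show ?thesis using small x y by metis
  next
    case False
    then have "x \<noteq> Std 0" "y \<noteq> Std 0" using rR by auto
    moreover have "\<bar>2 ^ a * int k - int l\<bar> \<le> int R" using pk R' by linarith
    ultimately show ?thesis using big[of x y] big[of x' y'] l False by simp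
  qed
qed

lemma tm_iter: "(\<exists>k i. t = (Sc ^^ k) (Var i)) \<or> (\<exists>k. t = (Sc ^^ k) Zero)"
proof (induction t)
  case (Sc t)
  then show ?case by (metis funpow.simps(2) comp_apply)
qed (metis funpow_0)+

lemma teval_iter: "teval e ((Sc ^^ k) t) = (suc ^^ k) (teval e t)"
  by (induction k) auto

lemma tfv_iter: "tfv ((Sc ^^ k) t) = tfv t"
  by (induction k) auto

text \<open>Treats both kinds of atoms at once: a = 0 is equality, a = 1 the complement of
  \<open>p\<close>.\<close>

lemma atom_invariant:
  assumes "tfv t \<subseteq> {..<n}" "tfv u \<subseteq> {..<n}"
  shows "\<exists>R. \<forall>e e'. agree R n e e' \<longrightarrow>
    (dbl ^^ a) (teval e t) = teval e u \<longleftrightarrow> (dbl ^^ a) (teval e' t) = teval e' u"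
proof -
  obtain k l t0 u0 where t: "t = (Sc ^^ k) t0" "t0 = Zero \<or> (\<exists>i<n. t0 = Var i)"
    and u: "u = (Sc ^^ l) u0" "u0 = Zero \<or> (\<exists>i<n. u0 = Var i)"
    using tm_iter[of t] tm_iter[of u] assms tfv_iter
    by (metis lessThan_iff singletonI subset_eq tfv.simps(1))
  define R where "R = 2 ^ a * (2 * k + l) + 2 * (k + l) + a"
  have "(dbl ^^ a) (teval e t) = teval e u \<longleftrightarrow> (dbl ^^ a) (teval e' t) = teval e' u"
    if ag: "agree R n e e'" for e e'
    unfolding t(1) u(1) teval_iter
  proof (rule dbl_suc_iter_eq_iff, unfold R_def[symmetric])
    show "\<bar>val (teval e t0)\<bar> \<le> int R \<or> \<bar>val (teval e' t0)\<bar> \<le> int R \<Longrightarrow> teval e t0 = teval e' t0"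
      using t(2) agree_small[OF ag] by auto
    show "\<bar>val (teval e u0)\<bar> \<le> int R \<or> \<bar>val (teval e' u0)\<bar> \<le> int R \<Longrightarrow> teval e u0 = teval e' u0"
      using u(2) agree_small[OF ag] by auto
    have aR: "a \<le> R" by (simp add: R_def)
    fix c assume "teval e t0 \<noteq> Std 0" "teval e u0 \<noteq> Std 0" "\<bar>c\<bar> \<le> int R"
    then show "linked a 0 c (teval e t0) (teval e u0) = linked a 0 c (teval e' t0) (teval e' u0)"
      using t(2) u(2) agree_linked[OF ag] aR by auto
  qed
  then show ?thesis by blast
qed

text \<open>Each quantifier raises the required rank by three applications of \<open>gap\<close>.
  The back move is the forth move with the tuples exchanged.\<close>

lemma sat_invariant:
  "fv A \<subseteq> {..<n} \<Longrightarrow> \<exists>R. \<forall>e e'. agree R n e e' \<longrightarrow> sat e A = sat e' A"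
proof (induction A arbitrary: n)
  case (Eql t u)
  then show ?case using atom_invariant[of t n u 0] by simp
next
  case (PAtom t u)
  then have "\<exists>R. \<forall>e e'. agree R n e e' \<longrightarrow>
      (dbl (teval e t) = teval e u) = (dbl (teval e' t) = teval e' u)"
    using atom_invariant[of t n u 1] by simp
  then show ?case by (metis sat.simps(2))
next
  case (Conj A B)
  then obtain R S where "\<forall>e e'. agree R n e e' \<longrightarrow> sat e A = sat e' A"
    "\<forall>e e'. agree S n e e' \<longrightarrow> sat e B = sat e' B" by (metis Un_subset_iff fv.simps(5))
  then show ?case by (intro exI[of _ "max R S"]) (metis agree_mono max.cobounded1 max.cobounded2 sat.simps(5))
next
  case (Disj A B)
  then obtain R S where "\<forall>e e'. agree R n e e' \<longrightarrow> sat e A = sat e' A"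
    "\<forall>e e'. agree S n e e' \<longrightarrow> sat e B = sat e' B" by (metis Un_subset_iff fv.simps(6))
  then show ?case by (intro exI[of _ "max R S"]) (metis agree_mono max.cobounded1 max.cobounded2 sat.simps(6))
next
  case (Imp A B)
  then obtain R S where "\<forall>e e'. agree R n e e' \<longrightarrow> sat e A = sat e' A"
    "\<forall>e e'. agree S n e e' \<longrightarrow> sat e B = sat e' B" by (metis Un_subset_iff fv.simps(7))
  then show ?case by (intro exI[of _ "max R S"]) (metis agree_mono max.cobounded1 max.cobounded2 sat.simps(7))
next
  case (All A)
  have "fv A \<subseteq> {..<Suc n}"
  proof
    fix x assume "x \<in> fv A" then show "x \<in> {..<Suc n}" using All.prems by (cases x) auto
  qed
  then obtain R where "\<forall>e e'. agree R (Suc n) e e' \<longrightarrow> sat e A = sat e' A" using All.IH by blast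
  then have "\<forall>e e'. agree (gap (gap (gap R))) n e e' \<longrightarrow> sat e (All A) = sat e' (All A)"
    using agree_ex_extend agree_sym by (metis sat.simps(8))
  then show ?case ..
next
  case (Ex A)
  have "fv A \<subseteq> {..<Suc n}"
  proof
    fix x assume "x \<in> fv A" then show "x \<in> {..<Suc n}" using Ex.prems by (cases x) auto
  qed
  then obtain R where "\<forall>e e'. agree R (Suc n) e e' \<longrightarrow> sat e A = sat e' A" using Ex.IH by blast
  then have "\<forall>e e'. agree (gap (gap (gap R))) n e e' \<longrightarrow> sat e (Ex A) = sat e' (Ex A)"
    using agree_ex_extend agree_sym by (metis sat.simps(9))
  then show ?case ..
qed auto

section \<open>Induction in the structure\<close>

lemma finite_fv: "finite (fv A)"
proof -
  have t: "finite (tfv t)" for t by (induction t) auto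
  have "finite {x. Suc x \<in> X}" if "finite X" for X
    using finite_vimageI[OF that, of Suc] by (simp add: vimage_def)
  then show ?thesis by (induction A) (auto simp: t)
qed

text \<open>
  If \<open>F\<close> fails somewhere, it fails at arbitrarily negative nonstandard points; but a sufficiently
  negative one cannot be distinguished from some standard point.
\<close>

lemma sat_induction:
  assumes "sat (case_nat (Std 0) e) F"
    and "\<And>x. sat (case_nat x e) F \<Longrightarrow> sat (case_nat (suc x) e) F"
  shows "sat (case_nat x e) F"
proof (rule ccontr)
  define P where "P x \<longleftrightarrow> sat (case_nat x e) F" for x
  assume "\<not> sat (case_nat x e) F"
  then have x: "\<not> P x" by (simp add: P_def)
  have step: "P x \<Longrightarrow> P (suc x)" for x using assms(2) by (simp add: P_def)
  have std: "P (Std m)" for m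
  proof (induction m)
    case 0
    then show ?case using assms(1) by (simp add: P_def)
  next
    case (Suc m)
    then show ?case using step[of "Std m"] by simp
  qed
  obtain n where "\<forall>x\<in>fv F. x < n"
    using finite_fv[of F] unfolding finite_nat_set_iff_bounded by blast
  \<comment> \<open>The tuple consists of the induction variable at index 0, followed by n entries
    of \<open>e\<close>.\<close>
  then have n: "fv F \<subseteq> {..<Suc n}" by (auto simp: less_Suc_eq)
  then obtain R where R: "\<And>e e'. agree R (Suc n) e e' \<Longrightarrow> sat e F = sat e' F"
    using sat_invariant by blast
  obtain z where "x = NonStd z" using x std by (cases x) auto
  have pred: "\<not> P (NonStd (z - int k))" for k
  proof (induction k)
    case 0
    then show ?case using x \<open>x = NonStd z\<close> by simp
  next
    case (Suc k)
    then show ?case using step[of "NonStd (z - int (Suc k))"] by auto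
  qed
  define B where "B = spread R n e"
  \<comment> \<open>A point below x, where \<open>F\<close> fails by descent, and at most -B - 1
    whatever the sign of z, hence beyond the spread of the parameters.\<close>
  define y where "y = NonStd (z - (\<bar>z\<bar> + B + 1))"
  have B: "0 \<le> B" "int R \<le> B" using spread_ge[of R n e] by (auto simp: B_def)
  have y: "B < \<bar>val y\<bar>" using B by (simp add: y_def)
  have "agree R n e e" by (simp add: agree_def)
  moreover have "int R < \<bar>val y\<bar>" using y B by linarith
  moreover have "\<not> linked a b c y (e j)" if "b \<le> R" "\<bar>c\<bar> \<le> int R" "j < n" for a b c j
    using not_linked_spread y that unfolding B_def by blast
  ultimately obtain m where "agree R (Suc n) (case_nat y e) (case_nat (Std m) e)"
    using agree_generic by blast
  then have "P y" using R std unfolding P_def by blast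
  then show False using pred[of "nat (\<bar>z\<bar> + B + 1)"] B by (simp add: y_def)
qed

section \<open>Soundness of LKID\<close>

definition valid :: "sequent \<Rightarrow> bool" where
  "valid S \<longleftrightarrow> (\<forall>e. (\<forall>A. A |\<in>| ante S \<longrightarrow> sat e A) \<longrightarrow> (\<exists>A. A |\<in>| succd S \<and> sat e A))"

lemma axiom_sequent_valid: "axiom_sequent S \<Longrightarrow> valid S"
  by (cases rule: axiom_sequent.cases) (auto simp: valid_def)

lemma sat_upd_fvs: "x \<notin> fvs \<Gamma> \<Longrightarrow> A |\<in>| \<Gamma> \<Longrightarrow> sat (e(x := d)) A = sat e A"
  by (rule sat_cong) (auto simp: fvs_def)

text \<open>The form in which eigenvariable conditions are used: the update at x affects the
  instance only through \<open>t\<close>.\<close>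

lemma sat_inst_upd:
  assumes "x \<notin> fv (All A)"
  shows "sat (e(x := d)) (inst A t) = sat (case_nat (teval (e(x := d)) t) e) A"
  unfolding sat_inst using assms by (intro sat_cong) (auto split: nat.split)

lemma common_rule_valid:
  assumes "common_rule r Ss S" "\<forall>S'\<in>set Ss. valid S'"
  shows "valid S"
  using assms
proof cases
  case (AllR x \<Gamma> \<Delta> A)
  show ?thesis
    unfolding AllR(3) valid_def
  proof (intro allI impI)
    fix e assume h: "\<forall>B. B |\<in>| ante (\<Gamma> \<turnstile> finsert (All A) \<Delta>) \<longrightarrow> sat e B"
    show "\<exists>B. B |\<in>| succd (\<Gamma> \<turnstile> finsert (All A) \<Delta>) \<and> sat e B"
    proof (cases "\<exists>B. B |\<in>| \<Delta> \<and> sat e B")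
      case False
      have "sat (case_nat d e) A" for d
      proof -
        have "\<forall>B. B |\<in>| \<Gamma> \<longrightarrow> sat (e(x := d)) B" using h AllR(4) by (auto simp: sat_upd_fvs)
        moreover have "\<forall>B. B |\<in>| \<Delta> \<longrightarrow> \<not> sat (e(x := d)) B" using False AllR(4) by (auto simp: sat_upd_fvs)
        ultimately have "sat (e(x := d)) (inst A (Var x))"
          using assms(2) AllR(2) by (fastforce simp: valid_def)
        then show ?thesis using sat_inst_upd[of x A e d "Var x"] AllR(4) by simp
      qed
      then show ?thesis by auto
    qed auto
  qed
next
  case (ExL x \<Gamma> \<Delta> A)
  show ?thesis
    unfolding ExL(3) valid_def
  proof (intro allI impI)
    fix e assume h: "\<forall>B. B |\<in>| ante (finsert (Ex A) \<Gamma> \<turnstile> \<Delta>) \<longrightarrow> sat e B"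
    then obtain d where d: "sat (case_nat d e) A" by auto
    have "\<forall>B. B |\<in>| \<Gamma> \<longrightarrow> sat (e(x := d)) B" using h ExL(4) by (auto simp: sat_upd_fvs)
    moreover have "sat (e(x := d)) (inst A (Var x))"
      using sat_inst_upd[of x A e d "Var x"] ExL(4) d by simp
    ultimately obtain B where "B |\<in>| \<Delta>" "sat (e(x := d)) B"
      using assms(2) ExL(2) by (fastforce simp: valid_def)
    then show "\<exists>B. B |\<in>| succd (finsert (Ex A) \<Gamma> \<turnstile> \<Delta>) \<and> sat e B"
      using ExL(4) by (auto simp: sat_upd_fvs)
  qed
next
  case (Sub \<Gamma> \<Delta> \<theta>)
  then show ?thesis using assms(2) by (fastforce simp: valid_def sat_subst)
next
  case (EqL x y t u \<Gamma> \<Delta>)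
  let ?\<theta> = "Var(x := t, y := u)" and ?\<theta>' = "Var(x := u, y := t)"
  have v: "valid (subst ?\<theta>' |`| \<Gamma> \<turnstile> subst ?\<theta>' |`| \<Delta>)" using assms(2) EqL(2) by simp
  show ?thesis
    unfolding EqL(3) valid_def
  proof (intro allI impI)
    fix e assume h: "\<forall>B. B |\<in>| ante (finsert (Eql t u) (subst ?\<theta> |`| \<Gamma>) \<turnstile> subst ?\<theta> |`| \<Delta>) \<longrightarrow> sat e B"
    then have "teval e t = teval e u" by auto
    \<comment> \<open>Since \<open>t\<close> and \<open>u\<close> have equal values, the two swapped
      substitutions induce the same assignment.\<close>
    then have eq: "sat e (subst ?\<theta> B) = sat e (subst ?\<theta>' B)" for B
      unfolding sat_subst by (intro sat_cong) auto
    have "sat e A" if "A |\<in>| subst ?\<theta>' |`| \<Gamma>" for A using h that eq by auto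
    moreover have "(\<forall>A. A |\<in>| subst ?\<theta>' |`| \<Gamma> \<longrightarrow> sat e A) \<longrightarrow>
        (\<exists>A. A |\<in>| subst ?\<theta>' |`| \<Delta> \<and> sat e A)"
      using v unfolding valid_def sequent.sel by (rule spec)
    ultimately obtain B where "B |\<in>| \<Delta>" "sat e (subst ?\<theta>' B)" by blast
    then show "\<exists>B. B |\<in>| succd (finsert (Eql t u) (subst ?\<theta> |`| \<Gamma>) \<turnstile> subst ?\<theta> |`| \<Delta>) \<and> sat e B"
      using eq by auto
  qed
next
  case (AllL A t \<Gamma> \<Delta>)
  then show ?thesis using assms(2) by (fastforce simp: valid_def sat_inst)
next
  case (ExR \<Gamma> A t \<Delta>)
  then show ?thesis using assms(2) by (fastforce simp: valid_def sat_inst)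
qed (use assms(2) in \<open>(fastforce simp: valid_def)+\<close>)

text \<open>\<open>NAtom t\<close> is true of every point, so the first two premises have to yield
  \<open>F\<close> on the whole domain; \<open>sat_induction\<close> provides this.\<close>

lemma ind_rule_valid:
  assumes "ind_rule Ss S" "\<forall>S'\<in>set Ss. valid S'"
  shows "valid S"
  using assms
proof cases
  case (1 x \<Gamma> \<Delta> F t)
  have v: "valid (\<Gamma> \<turnstile> finsert (inst F Zero) \<Delta>)"
    "valid (finsert (inst F (Var x)) \<Gamma> \<turnstile> finsert (inst F (Sc (Var x))) \<Delta>)"
    "valid (finsert (inst F t) \<Gamma> \<turnstile> \<Delta>)"
    using assms(2) 1(1) by auto
  show ?thesis
    unfolding 1(2) valid_def
  proof (intro allI impI, rule ccontr)
    fix e assume "\<forall>B. B |\<in>| ante (finsert (NAtom t) \<Gamma> \<turnstile> \<Delta>) \<longrightarrow> sat e B"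
      and "\<nexists>B. B |\<in>| succd (finsert (NAtom t) \<Gamma> \<turnstile> \<Delta>) \<and> sat e B"
    then have h: "\<And>B. B |\<in>| \<Gamma> \<Longrightarrow> sat e B" and n: "\<And>B. B |\<in>| \<Delta> \<Longrightarrow> \<not> sat e B" by auto
    have "sat e (inst F Zero)" using v(1) h n unfolding valid_def by (metis finsert_iff sequent.sel)
    then have "sat (case_nat (Std 0) e) F" by (simp add: sat_inst)
    moreover have "sat (case_nat (suc d) e) F" if "sat (case_nat d e) F" for d
    proof -
      have "sat (e(x := d)) B" if "B |\<in>| \<Gamma>" for B using h[OF that] 1(3) sat_upd_fvs[OF _ that] by simp
      moreover have "\<not> sat (e(x := d)) B" if "B |\<in>| \<Delta>" for B
        using n[OF that] 1(3) sat_upd_fvs[OF _ that] by simp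
      moreover have "sat (e(x := d)) (inst F (Var x))"
        using sat_inst_upd[of x F e d "Var x"] 1(3) that by simp
      ultimately have "sat (e(x := d)) (inst F (Sc (Var x)))"
        using v(2) unfolding valid_def by (metis finsert_iff sequent.sel)
      then show ?thesis using sat_inst_upd[of x F e d "Sc (Var x)"] 1(3) by simp
    qed
    ultimately have "sat e (inst F t)" unfolding sat_inst by (rule sat_induction)
    then show False using v(3) h n unfolding valid_def by (metis finsert_iff sequent.sel)
  qed
qed

lemma LKID_valid:
  assumes "LKID T S" "\<And>A e. A \<in> T \<Longrightarrow> sat e A"
  shows "valid S"
  using assms(1)
proof induction
  case (2 A)
  then show ?case using assms(2) by (auto simp: valid_def)
qed (auto intro: axiom_sequent_valid common_rule_valid ind_rule_valid)

lemma zero_s_axioms_sat: "A \<in> zero_s_axioms \<Longrightarrow> sat e A"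
  by (auto simp: zero_s_axioms_def suc_neq_zero dest: suc_inject)

text \<open>The base cases lie off the graph of \<open>dbl\<close>, and in each conditional a
  conclusion on the graph comes from a premise on the graph. The final universal statement fails at
  any pair x, \<open>dbl x\<close>.\<close>

lemma hydra_not_sat: "\<not> sat e hydra"
proof -
  have "dbl x \<noteq> suc (Std 0)" for x
  proof -
    have "nat (2 * z) \<noteq> Suc 0" for z
      using nat_eq_iff[of "2 * z" "Suc 0"] by presburger
    then show ?thesis by (cases x) auto
  qed
  then have a: "Std (Suc 0) \<noteq> dbl x" for x by (metis suc.simps(1))
  have b: "suc (suc y) \<noteq> dbl (suc x)" if "y \<noteq> dbl x" for x y
    using that by (cases x; cases y) (auto split: if_splits)
  \<comment> \<open>Only y = \<open>NonStd (-2)\<close> makes the jump land on the graph, and this y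
    is \<open>dbl (NonStd (-1))\<close>. The same point settles the next case.\<close>
  have c: "suc (suc y) \<noteq> dbl (Std 0)" if "y \<noteq> dbl (suc y)" for y
    using that by (cases y) (auto split: if_splits)
  have d: "Std 0 \<noteq> dbl (suc (suc y))" if "y \<noteq> dbl (suc y)" for y
    using that by (cases y) (auto split: if_splits)
  have "sat e hydra_a" by (simp add: hydra_a_def AllN_def a)
  moreover have "sat e hydra_b" by (simp add: hydra_b_def AllN_def b)
  moreover have "sat e hydra_c" by (simp add: hydra_c_def AllN_def c del: dbl.simps)
  moreover have "sat e hydra_d" by (simp add: hydra_d_def AllN_def d)
  moreover have "\<not> sat e (AllN (AllN (PAtom (Var 1) (Var 0))))" by (auto simp: AllN_def)
  ultimately show ?thesis by (simp add: hydra_def)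
qed

lemma not_LKID_hydra: "\<not> LKID zero_s_axioms ({||} \<turnstile> {|hydra|})"
  using LKID_valid[of zero_s_axioms] zero_s_axioms_sat hydra_not_sat by (fastforce simp: valid_def)

section \<open>Traces through the unfolding of a looping tree\<close>

definition hydra_loop :: sequent where
  "hydra_loop = ({|NAtom (Var 0), NAtom (Var 1), hydra_a, hydra_b, hydra_c, hydra_d|} \<turnstile>
    {|PAtom (Var 0) (Var 1)|})"

lemma not_axiom_hydra_loop: "\<not> axiom_sequent hydra_loop"
  by (auto simp: hydra_loop_def hydra_a_def hydra_b_def hydra_c_def hydra_d_def AllN_def
      elim!: axiom_sequent.cases)

text \<open>The Boolean records that progress still has to be made before the loop closes.\<close>

type_synonym thread = "fm \<times> bool"

fun thread_step :: "sequent \<Rightarrow> rule_label \<Rightarrow> thread \<Rightarrow> thread \<Rightarrow> bool" where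
  "thread_step S r (A, a) (B, b) \<longleftrightarrow> A |\<in>| ante S \<and> (\<exists>t. A = NAtom t) \<and> trace_step r A B \<and>
    (a \<longrightarrow> b \<or> (\<exists>t x. r = CaseSplit t x \<and> A = NAtom t \<and> B = NAtom (Var x)))"

text \<open>
  All buds are labelled \<open>hydra_loop\<close>.  On the branch to each of them there are two threads, ending
  in the two \<open>NAtom\<close> hypotheses of \<open>hydra_loop\<close>; \<open>K\<close> collects the possible
  pairs of their starting points.
\<close>

inductive threaded :: "dtree \<Rightarrow> (thread \<times> thread) set \<Rightarrow> bool" where
  axiom: "axiom_sequent S \<Longrightarrow> threaded (Leaf S) K"
| loop: "((NAtom (Var 0), False), (NAtom (Var 1), False)) \<in> K \<Longrightarrow> threaded (Leaf hydra_loop) K"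
| inner: "CLKID_rule r (map root_seq ds) S \<Longrightarrow>
    \<forall>d\<in>set ds. \<exists>K'. threaded d K' \<and>
      (\<forall>P' Q'. (P', Q') \<in> K' \<longrightarrow>
        (\<exists>P Q. (P, Q) \<in> K \<and> thread_step S r P P' \<and> thread_step S r Q Q')) \<Longrightarrow>
    threaded (Inner S r ds) K"

lemma threaded_derivation: "threaded d K \<Longrightarrow> derivation d"
  by (induction rule: threaded.induct) auto

lemma threaded_leaf:
  "threaded d K \<Longrightarrow> subtree_at d q = Some (Leaf S) \<Longrightarrow> axiom_sequent S \<or> S = hydra_loop"
proof (induction arbitrary: q rule: threaded.induct)
  case (axiom S' K)
  then show ?case by (cases q) auto
next
  case (loop K)
  then show ?case by (cases q) auto
next
  case (inner r ds S' K)
  then obtain i q' where q: "q = i # q'" by (cases q) auto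
  then have "ds ! i \<in> set ds" "subtree_at (ds ! i) q' = Some (Leaf S)"
    using inner.prems by (auto split: if_splits)
  then show ?case using inner.IH by blast
qed

text \<open>\<open>plug X d\<close> is the unfolding of \<open>d\<close> with \<open>X\<close> in place of the buds.\<close>

primrec plug :: "utree \<Rightarrow> dtree \<Rightarrow> utree" where
  "plug X (Leaf S) = (if axiom_sequent S then UNode S None [] else X)"
| "plug X (Inner S r ds) = UNode S (Some r) (map (plug X) ds)"

lemma subtree_at_append:
  "subtree_at d (q @ q') = Option.bind (subtree_at d q) (\<lambda>u. subtree_at u q')"
  by (induction d q rule: subtree_at.induct) auto

text \<open>All buds share the companion \<open>p\<close>, so the unfolding at \<open>p\<close> can
  be treated as an unanalysed tree, and ordinary induction on the finite subtree suffices.\<close>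

lemma unfolding_from_plug:
  assumes "subtree_at d p = Some (Inner S0 r0 ds0)" "subtree_at d q = Some u"
  shows "unfolding_from d (\<lambda>_. p) q = plug (unfolding_from d (\<lambda>_. p) p) u"
  using assms(2)
proof (induction u arbitrary: q)
  case (Leaf S)
  have p: "resolve d (\<lambda>_. p) p = p" by (simp add: resolve_def)
  show ?case
  proof (cases "axiom_sequent S")
    case True
    then have "resolve d (\<lambda>_. p) q = q" using Leaf by (auto simp: resolve_def bud_def)
    then show ?thesis using True Leaf by (intro utree.expand) simp
  next
    case False
    then have "resolve d (\<lambda>_. p) q = p" using Leaf by (auto simp: resolve_def bud_def)
    \<comment> \<open>Both positions resolve to \<open>p\<close>, so their corecursive equations
      have the same right-hand side.\<close>
    then have "unfolding_from d (\<lambda>_. p) q = unfolding_from d (\<lambda>_. p) p"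
      by (simp add: unfolding_from.code[of d _ q] unfolding_from.code[of d _ p] p)
    then show ?thesis using False by simp
  qed
next
  case (Inner S r ds)
  have q: "resolve d (\<lambda>_. p) q = q" using Inner.prems by (auto simp: resolve_def bud_def)
  have "unfolding_from d (\<lambda>_. p) (q @ [i]) = plug (unfolding_from d (\<lambda>_. p) p) (ds ! i)"
    if "i < length ds" for i
    using that Inner.prems by (intro Inner.IH) (auto simp: subtree_at_append)
  then have "map (\<lambda>i. unfolding_from d (\<lambda>_. p) (q @ [i])) [0..<length ds] =
      map (plug (unfolding_from d (\<lambda>_. p) p)) ds"
    by (intro nth_equalityI) auto
  then show ?case using Inner.prems q by (subst unfolding_from.code) simp
qed

section \<open>Traces assembled from segments of a path\<close>

text \<open>The conditions on nodes cover a half-open interval; that the last formula stands in its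
  antecedent is left to the following segment.\<close>

definition trace_segment :: "(nat \<Rightarrow> utree) \<Rightarrow> nat \<Rightarrow> nat \<Rightarrow> thread \<Rightarrow> fm \<Rightarrow> (nat \<Rightarrow> fm) \<Rightarrow> bool" where
  "trace_segment \<pi> i j P B \<tau> \<longleftrightarrow> \<tau> i = fst P \<and> \<tau> j = B \<and>
    (\<forall>l. i \<le> l \<and> l < j \<longrightarrow> \<tau> l |\<in>| ante (useq (\<pi> l)) \<and> (\<exists>t. \<tau> l = NAtom t) \<and>
      (\<exists>r. urule (\<pi> l) = Some r \<and> trace_step r (\<tau> l) (\<tau> (Suc l)))) \<and>
    (snd P \<longrightarrow> (\<exists>l. i \<le> l \<and> l < j \<and> progress_point \<pi> \<tau> l))"

lemma trace_segment_step:
  assumes "trace_segment \<pi> (Suc i) j P' B \<tau>" "Suc i \<le> j"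
    and "useq (\<pi> i) = S" "urule (\<pi> i) = Some r" "thread_step S r P P'"
  shows "trace_segment \<pi> i j P B (\<tau>(i := fst P))"
proof -
  obtain A a A' a' where P: "P = (A, a)" "P' = (A', a')" by fastforce
  have "progress_point \<pi> (\<tau>(i := A)) l \<longleftrightarrow> progress_point \<pi> \<tau> l" if "Suc i \<le> l" for l
    using that by (simp add: progress_point_def)
  moreover have "progress_point \<pi> (\<tau>(i := A)) i"
    if "\<exists>t x. r = CaseSplit t x \<and> A = NAtom t \<and> A' = NAtom (Var x)"
    using that assms P by (auto simp: progress_point_def trace_segment_def)
  moreover have "\<exists>l. i \<le> l \<and> l < j \<and> progress_point \<pi> (\<tau>(i := A)) l" if a
    using that assms P calculation unfolding trace_segment_def
    by simp (metis Suc_leD Suc_le_lessD order_refl)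
  moreover have "(\<tau>(i := A)) l |\<in>| ante (useq (\<pi> l)) \<and> (\<exists>t. (\<tau>(i := A)) l = NAtom t) \<and>
      (\<exists>r. urule (\<pi> l) = Some r \<and> trace_step r ((\<tau>(i := A)) l) ((\<tau>(i := A)) (Suc l)))"
    if "i \<le> l" "l < j" for l
  proof (cases "l = i")
    case True
    then show ?thesis using assms P by (simp add: trace_segment_def)
  next
    case False
    then show ?thesis using assms(1) that by (simp add: trace_segment_def)
  qed
  moreover have "(\<tau>(i := A)) j = B" using assms(1,2) by (auto simp: trace_segment_def)
  ultimately show ?thesis unfolding trace_segment_def P by simp
qed

text \<open>An infinite path cannot stop at an axiom leaf, so it leaves \<open>d\<close> through a
  bud into \<open>X\<close>. Read backwards from the bud, the step condition of
  \<open>threaded\<close> yields two segments that start in a pair of \<open>K\<close>.\<close>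

lemma threaded_path:
  assumes "threaded d K" "\<And>i. \<pi> (Suc i) \<in> set (uchildren (\<pi> i))" "\<pi> k = plug X d"
  shows "\<exists>n P Q \<tau> \<tau>'. (P, Q) \<in> K \<and> \<pi> (k + n) = X \<and>
    trace_segment \<pi> k (k + n) P (NAtom (Var 0)) \<tau> \<and>
    trace_segment \<pi> k (k + n) Q (NAtom (Var 1)) \<tau>' \<and> ((\<exists>S. d = Leaf S) \<or> 0 < n)"
  using assms(1,3)
proof (induction arbitrary: k rule: threaded.induct)
  case (axiom S K)
  then show ?case using assms(2)[of k] by simp
next
  case (loop K)
  then have "\<pi> (k + 0) = X" by (simp add: not_axiom_hydra_loop)
  moreover have "trace_segment \<pi> k (k + 0) (A, False) A (\<lambda>_. A)" for A
    by (auto simp: trace_segment_def)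
  ultimately show ?case
    using loop(1)
    by - (rule exI[of _ 0], rule exI[of _ "(NAtom (Var 0), False)"],
        rule exI[of _ "(NAtom (Var 1), False)"], rule exI[of _ "\<lambda>_. NAtom (Var 0)"],
        rule exI[of _ "\<lambda>_. NAtom (Var 1)"], simp)
next
  case (inner r ds S K)
  obtain d where d: "d \<in> set ds" "\<pi> (Suc k) = plug X d"
    using assms(2)[of k] inner.prems by auto
  obtain K' where K': "\<And>k. \<pi> k = plug X d \<Longrightarrow> \<exists>n P Q \<tau> \<tau>'. (P, Q) \<in> K' \<and> \<pi> (k + n) = X \<and>
      trace_segment \<pi> k (k + n) P (NAtom (Var 0)) \<tau> \<and>
      trace_segment \<pi> k (k + n) Q (NAtom (Var 1)) \<tau>' \<and> ((\<exists>S. d = Leaf S) \<or> 0 < n)"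
    and step: "\<And>P' Q'. (P', Q') \<in> K' \<Longrightarrow>
      \<exists>P Q. (P, Q) \<in> K \<and> thread_step S r P P' \<and> thread_step S r Q Q'"
    using inner.IH d(1) by blast
  obtain n P' Q' \<tau> \<tau>' where n: "(P', Q') \<in> K'" "\<pi> (Suc k + n) = X"
    "trace_segment \<pi> (Suc k) (Suc k + n) P' (NAtom (Var 0)) \<tau>"
    "trace_segment \<pi> (Suc k) (Suc k + n) Q' (NAtom (Var 1)) \<tau>'"
    using K'[OF d(2)] by blast
  obtain P Q where PQ: "(P, Q) \<in> K" "thread_step S r P P'" "thread_step S r Q Q'"
    using step[OF n(1)] by blast
  have u: "useq (\<pi> k) = S" "urule (\<pi> k) = Some r" using inner.prems by auto
  have "trace_segment \<pi> k (k + Suc n) P (NAtom (Var 0)) (\<tau>(k := fst P))"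
    "trace_segment \<pi> k (k + Suc n) Q (NAtom (Var 1)) (\<tau>'(k := fst Q))"
    using trace_segment_step[OF n(3) _ u PQ(2)] trace_segment_step[OF n(4) _ u PQ(3)] by auto
  then show ?case using PQ(1) n(2)
    by - (rule exI[of _ "Suc n"], rule exI[of _ P], rule exI[of _ Q], rule exI[of _ "\<tau>(k := fst P)"],
        rule exI[of _ "\<tau>'(k := fst Q)"], simp del: fun_upd_apply)
qed

lemma trace_glue:
  assumes "strict_mono t" and seg: "\<And>r. trace_segment \<pi> (t r) (t (Suc r)) (\<sigma> r, True) (\<sigma> (Suc r)) (L r)"
  shows "\<exists>\<tau>. is_trace (\<lambda>i. \<pi> (t 0 + i)) \<tau> \<and> infinite {i. progress_point (\<lambda>i. \<pi> (t 0 + i)) \<tau> i}"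
proof -
  have ex: "\<exists>r. t r \<le> i \<and> i < t (Suc r)" if "t 0 \<le> i" for i
  proof -
    have "\<exists>r. t r \<le> i \<and> i < t (Suc r)" if "i < t k" for k
      using that
    proof (induction k)
      case (Suc k)
      then show ?case by (cases "i < t k") (auto intro: exI[of _ k])
    qed (use \<open>t 0 \<le> i\<close> in simp)
    moreover have "i < t (Suc i)" using strict_mono_imp_increasing[OF assms(1), of "Suc i"] by simp
    ultimately show ?thesis by blast
  qed
  define \<rho> where "\<rho> i = (THE r. t r \<le> i \<and> i < t (Suc r))" for i
  have \<rho>: "\<rho> i = r" if "t r \<le> i" "i < t (Suc r)" for i r
    unfolding \<rho>_def
  proof (rule the_equality)
    fix r' assume h: "t r' \<le> i \<and> i < t (Suc r')"
    then have "t r' < t (Suc r)" "t r < t (Suc r')" using that by auto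
    then have "r' < Suc r" "r < Suc r'" using strict_mono_less[OF assms(1)] by blast+
    then show "r' = r" by simp
  qed (use that in simp)
  define T where "T i = L (\<rho> i) i" for i
  \<comment> \<open>At a boundary \<rho> already names the next segment; the neighbours agree there,
    both having \<sigma> (Suc r).\<close>
  have T: "T i = L r i" if "t r \<le> i" "i \<le> t (Suc r)" for i r
  proof (cases "i = t (Suc r)")
    case True
    have "\<rho> i = Suc r" using True strict_mono_less[OF assms(1)] by (intro \<rho>) auto
    then show ?thesis using seg[of r] seg[of "Suc r"] True by (simp add: T_def trace_segment_def)
  next
    case False
    then show ?thesis using \<rho>[of r i] that by (simp add: T_def)
  qed
  have s: "T i |\<in>| ante (useq (\<pi> i)) \<and> (\<exists>t. T i = NAtom t) \<and>
      (\<exists>r. urule (\<pi> i) = Some r \<and> trace_step r (T i) (T (Suc i)))" if "t 0 \<le> i" for i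
  proof -
    obtain r where r: "t r \<le> i" "i < t (Suc r)" using ex \<open>t 0 \<le> i\<close> by blast
    then have "T i = L r i" "T (Suc i) = L r (Suc i)" by (auto intro: T)
    then show ?thesis using seg[of r] r by (simp add: trace_segment_def)
  qed
  have "is_trace (\<lambda>i. \<pi> (t 0 + i)) (\<lambda>i. T (t 0 + i))"
    using s by (simp add: is_trace_def)
  moreover have "infinite {i. progress_point (\<lambda>i. \<pi> (t 0 + i)) (\<lambda>i. T (t 0 + i)) i}"
    unfolding infinite_nat_iff_unbounded_le
  proof
    fix m
    \<comment> \<open>Segment number t 0 + m starts at this index or later, so its progress point
      has relative position at least m.\<close>
    have m: "t 0 + m \<le> t (t 0 + m)" using strict_mono_imp_increasing[OF assms(1)] .
    let ?r = "t 0 + m"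
    obtain l where l: "t ?r \<le> l" "l < t (Suc ?r)" "progress_point \<pi> (L ?r) l"
      using seg[of ?r] by (auto simp: trace_segment_def)
    then have "T l = L ?r l" "T (Suc l) = L ?r (Suc l)" by (auto intro: T)
    moreover have i: "l = t 0 + (l - t 0)" "m \<le> l - t 0" using m l(1) by auto
    ultimately have "progress_point (\<lambda>i. \<pi> (t 0 + i)) (\<lambda>i. T (t 0 + i)) (l - t 0)"
      using l(3) by (simp add: progress_point_def)
    then show "\<exists>n\<ge>m. n \<in> {i. progress_point (\<lambda>i. \<pi> (t 0 + i)) (\<lambda>i. T (t 0 + i)) i}"
      using i(2) by blast
  qed
  ultimately show ?thesis by blast
qed

text \<open>\<open>\<sigma> r\<close> is determined by the next constant map among \<open>G r, G (r + 1), \<dots>\<close>.\<close>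

lemma backward_choice:
  assumes "\<And>r. G r \<in> {id, \<lambda>_. True, \<lambda>_. False}"
  shows "\<exists>\<sigma> :: nat \<Rightarrow> bool. \<forall>r. \<sigma> r = G r (\<sigma> (Suc r))"
proof -
  define Q where "Q r r' \<longleftrightarrow> r \<le> r' \<and> G r' \<noteq> id" for r r'
  \<comment> \<open>If only identity maps follow, \<sigma> is False from there on, a constant
    solution.\<close>
  define \<sigma> where "\<sigma> r = ((\<exists>r'. Q r r') \<and> G (LEAST r'. Q r r') True)" for r
  have "\<sigma> r = G r (\<sigma> (Suc r))" for r
  proof (cases "G r = id")
    case True
    have "Q r r' \<longleftrightarrow> Q (Suc r) r'" for r'
      using True by (cases "r = r'") (auto simp: Q_def)
    then have "\<sigma> r = \<sigma> (Suc r)" unfolding \<sigma>_def by presburger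
    then show ?thesis using True by simp
  next
    case False
    then have "Q r r" by (simp add: Q_def)
    moreover have "(LEAST r'. Q r r') = r"
      using \<open>Q r r\<close> by (intro Least_equality) (auto simp: Q_def)
    ultimately have "\<sigma> r = G r True" unfolding \<sigma>_def by metis
    moreover have "G r True = G r b" for b using False assms[of r] by auto
    ultimately show ?thesis by blast
  qed
  then show ?thesis by blast
qed


section \<open>Derived rules\<close>

definition provable :: "sequent \<Rightarrow> (thread \<times> thread) set \<Rightarrow> bool" where
  "provable S K \<longleftrightarrow> (\<exists>d. root_seq d = S \<and> threaded d K)"

lemma provable_axiom: "axiom_sequent S \<Longrightarrow> provable S K"
  unfolding provable_def by (metis root_seq.simps(1) threaded.axiom)

lemma provable_rule:
  assumes "CLKID_rule r Ss S"
    and "\<forall>S'\<in>set Ss. \<exists>K'. provable S' K' \<and> (\<forall>P' Q'. (P', Q') \<in> K' \<longrightarrow>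
      (\<exists>P Q. (P, Q) \<in> K \<and> thread_step S r P P' \<and> thread_step S r Q Q'))"
  shows "provable S K"
proof -
  let ?ok = "\<lambda>d. \<exists>K'. threaded d K' \<and> (\<forall>P' Q'. (P', Q') \<in> K' \<longrightarrow>
      (\<exists>P Q. (P, Q) \<in> K \<and> thread_step S r P P' \<and> thread_step S r Q Q'))"
  have "\<forall>S'\<in>set Ss. \<exists>d. root_seq d = S' \<and> ?ok d"
    using assms(2) unfolding provable_def by blast
  then obtain f where f: "\<forall>S'\<in>set Ss. root_seq (f S') = S' \<and> ?ok (f S')"
    by metis
  then have "map root_seq (map f Ss) = Ss" by (simp add: map_idI)
  then have "threaded (Inner S r (map f Ss)) K"
    using f assms(1) by (intro threaded.inner) auto
  then show ?thesis unfolding provable_def by (metis root_seq.simps(2))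
qed

text \<open>Rules labelled \<open>Other\<close> do not move trace atoms, so a set of threads passes
  through them unchanged if its atoms stand in the antecedent of the conclusion.\<close>

definition admits :: "sequent \<Rightarrow> (thread \<times> thread) set \<Rightarrow> bool" where
  "admits S K \<longleftrightarrow> (\<forall>P Q. (P, Q) \<in> K \<longrightarrow>
    (\<exists>A a B b. P = (NAtom A, a) \<and> Q = (NAtom B, b) \<and> NAtom A |\<in>| ante S \<and> NAtom B |\<in>| ante S))"

lemma provable_common:
  assumes "common_rule Other Ss S" "\<forall>S'\<in>set Ss. provable S' K \<or> provable S' {}" "admits S K"
  shows "provable S K"
proof (rule provable_rule[of Other Ss])
  have "\<forall>P' Q'. (P', Q') \<in> K \<longrightarrow> (\<exists>P Q. (P, Q) \<in> K \<and> thread_step S Other P P' \<and> thread_step S Other Q Q')"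
    using assms(3) unfolding admits_def by fastforce
  then show "\<forall>S'\<in>set Ss. \<exists>K'. provable S' K' \<and> (\<forall>P' Q'. (P', Q') \<in> K' \<longrightarrow>
      (\<exists>P Q. (P, Q) \<in> K \<and> thread_step S Other P P' \<and> thread_step S Other Q Q'))"
    using assms(2) by (meson empty_iff)
qed (use assms(1) in \<open>rule CLKID_rule.intros\<close>)

lemma admits_empty: "admits S {}"
  by (simp add: admits_def)

lemma provable_weaken:
  assumes "provable (\<Gamma>' \<turnstile> \<Delta>') K" "\<Gamma>' |\<subseteq>| \<Gamma>" "\<Delta>' |\<subseteq>| \<Delta>" "admits (\<Gamma> \<turnstile> \<Delta>) K"
  shows "provable (\<Gamma> \<turnstile> \<Delta>) K"
  using provable_common[OF Weak[OF assms(2,3)]] assms by simp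

text \<open>An empty set of threads excludes buds, so this is finite provability without
  loops.\<close>

definition entails :: "fm fset \<Rightarrow> fm \<Rightarrow> bool" where
  "entails \<Gamma> B \<longleftrightarrow> provable (\<Gamma> \<turnstile> {|B|}) {}"

lemma entails_assumption: "B |\<in>| \<Gamma> \<Longrightarrow> entails \<Gamma> B"
  unfolding entails_def by (intro provable_axiom Ax) auto

lemma entails_right: "entails \<Gamma> B \<Longrightarrow> B |\<in>| \<Delta> \<Longrightarrow> provable (\<Gamma> \<turnstile> \<Delta>) {}"
  unfolding entails_def by (erule provable_weaken) (auto simp: admits_empty)

lemma entails_Imp:
  assumes "Imp A B |\<in>| \<Gamma>" "entails \<Gamma> A" "entails (finsert B \<Gamma>) C" shows "entails \<Gamma> C"
proof -
  have "provable (\<Gamma> \<turnstile> finsert A {|C|}) {}" using assms(2) by (rule entails_right) simp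
  then show ?thesis
    using provable_common[OF ImpL[of \<Gamma> A "{|C|}" B], of "{}"] assms(1,3)
    by (simp add: entails_def admits_empty finsert_absorb)
qed

lemma entails_Conj:
  assumes "Conj A B |\<in>| \<Gamma>" "entails (finsert A (finsert B \<Gamma>)) C" shows "entails \<Gamma> C"
  using provable_common[OF ConjL[of A B \<Gamma> "{|C|}"], of "{}"] assms
  by (simp add: entails_def admits_empty finsert_absorb)

lemma entails_AllN:
  assumes "AllN A |\<in>| \<Gamma>" "NAtom t |\<in>| \<Gamma>" "entails (finsert (inst A t) \<Gamma>) C" shows "entails \<Gamma> C"
proof -
  let ?I = "inst (Imp (NAtom (Var 0)) A) t"
  have I: "?I = Imp (NAtom t) (inst A t)" by (simp add: inst_def)
  have "provable (finsert (inst A t) \<Gamma> \<turnstile> {|C|}) {}" using assms(3) by (simp add: entails_def)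
  then have "provable (finsert (inst A t) (finsert ?I \<Gamma>) \<turnstile> {|C|}) {}"
    by (rule provable_weaken) (auto simp: admits_empty)
  then have "entails (finsert ?I \<Gamma>) C"
    using entails_Imp[of "NAtom t" "inst A t" "finsert ?I \<Gamma>" C] assms(2)
    by (simp add: entails_def[symmetric] I entails_assumption)
  then show ?thesis
    using provable_common[OF AllL[of "Imp (NAtom (Var 0)) A" t \<Gamma> "{|C|}"], of "{}"] assms(1)
    by (simp add: entails_def admits_empty AllN_def finsert_absorb)
qed

lemma entails_cut: "entails \<Gamma> A \<Longrightarrow> entails (finsert A \<Gamma>) B \<Longrightarrow> entails \<Gamma> B"
  using provable_common[OF Cut[of \<Gamma> A "{|B|}"], of "{}"] entails_right[of \<Gamma> A "{|A, B|}"]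
  by (simp add: entails_def admits_empty)

lemma entails_mono: "entails \<Gamma>' B \<Longrightarrow> \<Gamma>' |\<subseteq>| \<Gamma> \<Longrightarrow> entails \<Gamma> B"
  unfolding entails_def by (erule provable_weaken) (auto simp: admits_empty)

section \<open>Replacement by equations\<close>

lemma tsubst_cong: "(\<And>x. x \<in> tfv t \<Longrightarrow> \<theta> x = \<theta>' x) \<Longrightarrow> tsubst \<theta> t = tsubst \<theta>' t"
  by (induction t) auto

lemma tsubst_Var: "tsubst Var t = t"
  by (induction t) auto

lemma tsubst_idle: "(\<And>x. x \<in> tfv t \<Longrightarrow> \<theta> x = Var x) \<Longrightarrow> tsubst \<theta> t = t"
  using tsubst_cong[of t \<theta> Var] tsubst_Var by simp

lemma tfv_tsubst: "tfv (tsubst \<theta> t) = (\<Union>x\<in>tfv t. tfv (\<theta> x))"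
  by (induction t) auto

lemma finite_tfv: "finite (tfv t)"
  by (induction t) auto

text \<open>\<open>EqL\<close> exchanges two terms simultaneously. For plain replacement, x marks
  the positions and y is fresh, so that its substitution has no effect. The marked atom stands in
  the succedent for one direction and in the antecedent for the other.\<close>

lemma
  fixes x :: nat and a b t u :: tm
  defines "B s \<equiv> PAtom (tsubst (Var(x := s)) a) (tsubst (Var(x := s)) b)"
  assumes eq: "Eql t u |\<in>| \<Gamma>" and x: "x \<notin> tfv t \<union> tfv u"
  shows entails_Eql_left: "entails \<Gamma> (B u) \<Longrightarrow> entails \<Gamma> (B t)"
    and entails_Eql_right: "entails \<Gamma> (B t) \<Longrightarrow> entails \<Gamma> (B u)"
proof -
  have "finite (insert x (tfv a \<union> tfv b \<union> tfv t \<union> tfv u))" by (simp add: finite_tfv)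
  then obtain y where y: "y \<notin> insert x (tfv a \<union> tfv b \<union> tfv t \<union> tfv u)"
    using ex_new_if_finite infinite_UNIV_nat by blast
  have idle: "subst (Var(x := v, y := w)) (B s) = B s" if "s \<in> {t, u}" for v w s
  proof -
    have "tsubst (Var(x := v, y := w)) (tsubst (Var(x := s)) c) = tsubst (Var(x := s)) c"
      if "c \<in> {a, b}" for c
      using that \<open>s \<in> {t, u}\<close> x y by (intro tsubst_idle) (auto simp: tfv_tsubst split: if_splits)
    then show ?thesis by (simp add: B_def)
  qed
  have hole: "subst (Var(x := v, y := w)) (PAtom a b) = B v" for v w
  proof -
    have "tsubst (Var(x := v, y := w)) c = tsubst (Var(x := v)) c" if "c \<in> {a, b}" for c
      using that y by (intro tsubst_cong) auto
    then show ?thesis by (simp add: B_def)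
  qed
  have xy: "x \<noteq> y" using y by simp
  have EqL': "provable (finsert (Eql t u) (subst (Var(x := t, y := u)) |`| \<Gamma>')
        \<turnstile> subst (Var(x := t, y := u)) |`| \<Delta>') {}"
    if "provable (subst (Var(x := u, y := t)) |`| \<Gamma>' \<turnstile> subst (Var(x := u, y := t)) |`| \<Delta>') {}"
    for \<Gamma>' \<Delta>'
    using CLKID_rule.intros(1)[OF EqL[OF xy, of t u \<Gamma>' \<Delta>']] that
    by (rule_tac provable_rule) auto
  have "entails (finsert (Eql t u) {|B u|}) (B t)"
    using EqL'[of "{|B u|}" "{|PAtom a b|}"] entails_assumption[of "B u" "{|B u|}"]
    by (simp add: hole idle entails_def del: subst.simps fun_upd_apply)
  then show "entails \<Gamma> (B t)" if "entails \<Gamma> (B u)"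
    using that eq by (intro entails_cut[OF that]) (auto elim!: entails_mono)
  have "entails (finsert (Eql t u) {|B t|}) (B u)"
    using EqL'[of "{|PAtom a b|}" "{|B u|}"] entails_assumption[of "B u" "{|B u|}"]
    by (simp add: hole idle entails_def del: subst.simps fun_upd_apply)
  then show "entails \<Gamma> (B u)" if "entails \<Gamma> (B t)"
    using that eq by (intro entails_cut[OF that]) (auto elim!: entails_mono)
qed


section \<open>Case splits, loops and the hydra hypotheses as derived rules\<close>

text \<open>Antecedents are sets, so the principal \<open>NAtom t\<close> can stay in the premises;
  a thread on it may wait or progress.\<close>

lemma provable_CaseSplit:
  assumes t: "NAtom t |\<in>| \<Gamma>" and x: "x \<notin> fvs \<Gamma> \<union> fvs \<Delta>"
    and "provable (finsert (Eql t Zero) \<Gamma> \<turnstile> \<Delta>) K1"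
    and "provable (finsert (Eql t (Sc (Var x))) (finsert (NAtom (Var x)) \<Gamma>) \<turnstile> \<Delta>) K2"
    and step: "\<forall>(P', Q')\<in>K1 \<union> K2. \<exists>(P, Q)\<in>K.
      thread_step (\<Gamma> \<turnstile> \<Delta>) (CaseSplit t x) P P' \<and> thread_step (\<Gamma> \<turnstile> \<Delta>) (CaseSplit t x) Q Q'"
  shows "provable (\<Gamma> \<turnstile> \<Delta>) K"
proof (rule provable_rule)
  have "x \<notin> fvs \<Gamma> \<union> fvs \<Delta> \<union> fv (NAtom t)" using t x by (auto simp: fvs_def)
  from CLKID_rule.intros(2)[OF this] show "CLKID_rule (CaseSplit t x)
      [finsert (Eql t Zero) \<Gamma> \<turnstile> \<Delta>,
       finsert (Eql t (Sc (Var x))) (finsert (NAtom (Var x)) \<Gamma>) \<turnstile> \<Delta>] (\<Gamma> \<turnstile> \<Delta>)"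
    using t by (simp add: finsert_absorb)
  show "\<forall>S'\<in>set [finsert (Eql t Zero) \<Gamma> \<turnstile> \<Delta>,
      finsert (Eql t (Sc (Var x))) (finsert (NAtom (Var x)) \<Gamma>) \<turnstile> \<Delta>].
    \<exists>K'. provable S' K' \<and> (\<forall>P' Q'. (P', Q') \<in> K' \<longrightarrow> (\<exists>P Q. (P, Q) \<in> K \<and>
      thread_step (\<Gamma> \<turnstile> \<Delta>) (CaseSplit t x) P P' \<and> thread_step (\<Gamma> \<turnstile> \<Delta>) (CaseSplit t x) Q Q'))"
  proof -
    have "\<exists>P Q. (P, Q) \<in> K \<and> thread_step (\<Gamma> \<turnstile> \<Delta>) (CaseSplit t x) P P' \<and>
        thread_step (\<Gamma> \<turnstile> \<Delta>) (CaseSplit t x) Q Q'" if "(P', Q') \<in> K1 \<union> K2" for P' Q'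
      using bspec[OF step that] by auto
    then show ?thesis using assms(3,4) by (metis UnCI empty_iff empty_set set_ConsD)
  qed
qed

abbreviation hydra_hyps :: "fm fset" where
  "hydra_hyps \<equiv> {|hydra_a, hydra_b, hydra_c, hydra_d|}"

lemmas hydra_defs = hydra_a_def hydra_b_def hydra_c_def hydra_d_def AllN_def

lemma subst_hydra_hyps: "A |\<in>| hydra_hyps \<Longrightarrow> subst \<theta> A = A"
  by (auto simp: hydra_defs lift_def)

lemma fv_hydra_hyps: "A |\<in>| hydra_hyps \<Longrightarrow> fv A = {}"
  by (auto simp: hydra_defs)

text \<open>A bud below a substitution that renames its two variables. The hydra hypotheses are
  closed and stay as they are; the threads are renamed along.\<close>

lemma provable_loop:
  "provable (finsert (NAtom (Var v)) (finsert (NAtom (Var w)) hydra_hyps) \<turnstile> {|PAtom (Var v) (Var w)|})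
    {((NAtom (Var v), False), (NAtom (Var w), False))}"
proof -
  let ?\<theta> = "Var(0 := Var v, 1 := Var w)" and ?S = "hydra_loop"
  let ?S' = "(finsert (NAtom (Var v)) (finsert (NAtom (Var w)) hydra_hyps) \<turnstile> {|PAtom (Var v) (Var w)|})"
  have "common_rule (Substitution ?\<theta>) [?S]
      (subst ?\<theta> |`| ante ?S \<turnstile> subst ?\<theta> |`| succd ?S)"
    using Sub[of ?\<theta> "ante ?S" "succd ?S"] by simp
  also have "(subst ?\<theta> |`| ante ?S \<turnstile> subst ?\<theta> |`| succd ?S) = ?S'"
    by (simp add: hydra_loop_def subst_hydra_hyps)
  finally have "CLKID_rule (Substitution ?\<theta>) [?S] ?S'" by (rule CLKID_rule.intros)
  moreover have "provable ?S {((NAtom (Var 0), False), (NAtom (Var 1), False))}"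
    unfolding provable_def by (metis root_seq.simps(1) threaded.loop singletonI)
  ultimately show ?thesis
    by (rule_tac provable_rule) auto
qed

text \<open>The left premise of the cut leads to the bud and carries all threads; the right one uses
  the cut formula without loops.\<close>

lemma provable_cut_loop:
  assumes "NAtom (Var v) |\<in>| \<Gamma>" "NAtom (Var w) |\<in>| \<Gamma>" "hydra_hyps |\<subseteq>| \<Gamma>"
    and "entails (finsert (PAtom (Var v) (Var w)) \<Gamma>) B"
  shows "provable (\<Gamma> \<turnstile> {|B|}) {((NAtom (Var v), False), (NAtom (Var w), False))}"
proof -
  let ?A = "PAtom (Var v) (Var w)"
  let ?K = "{((NAtom (Var v), False), (NAtom (Var w), False))}"
  have "provable (\<Gamma> \<turnstile> finsert ?A {|B|}) ?K"
    by (rule provable_weaken[OF provable_loop]) (use assms(1-3) in \<open>auto simp: admits_def\<close>)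
  moreover have "admits (\<Gamma> \<turnstile> {|B|}) ?K" using assms(1,2) by (auto simp: admits_def)
  ultimately show ?thesis
    using assms(4) provable_common[OF Cut[of \<Gamma> ?A "{|B|}"], of ?K]
    by (simp add: entails_def)
qed

lemma tsubst_iter: "tsubst \<theta> ((Sc ^^ k) t) = (Sc ^^ k) (tsubst \<theta> t)"
  by (induction k) auto

lemma
  assumes eq: "Eql t u |\<in>| \<Gamma>"
  shows entails_PAtom_left: "entails \<Gamma> (PAtom ((Sc ^^ k) u) c) \<Longrightarrow> entails \<Gamma> (PAtom ((Sc ^^ k) t) c)"
    and entails_PAtom_right: "entails \<Gamma> (PAtom c ((Sc ^^ k) u)) \<Longrightarrow> entails \<Gamma> (PAtom c ((Sc ^^ k) t))"
    and entails_PAtom_left': "entails \<Gamma> (PAtom ((Sc ^^ k) t) c) \<Longrightarrow> entails \<Gamma> (PAtom ((Sc ^^ k) u) c)"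
proof -
  have "finite (tfv c \<union> tfv t \<union> tfv u)" by (simp add: finite_tfv)
  from ex_new_if_finite[OF infinite_UNIV_nat this]
  obtain x where x: "x \<notin> tfv c \<union> tfv t \<union> tfv u" ..
  then have xtu: "x \<notin> tfv t \<union> tfv u" by simp
  have c: "tsubst (Var(x := s)) c = c" for s using x by (intro tsubst_idle) auto
  show "entails \<Gamma> (PAtom ((Sc ^^ k) u) c) \<Longrightarrow> entails \<Gamma> (PAtom ((Sc ^^ k) t) c)"
    using entails_Eql_left[OF eq xtu, of "(Sc ^^ k) (Var x)" c] by (simp add: c tsubst_iter)
  show "entails \<Gamma> (PAtom c ((Sc ^^ k) u)) \<Longrightarrow> entails \<Gamma> (PAtom c ((Sc ^^ k) t))"
    using entails_Eql_left[OF eq xtu, of c "(Sc ^^ k) (Var x)"] by (simp add: c tsubst_iter)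
  show "entails \<Gamma> (PAtom ((Sc ^^ k) t) c) \<Longrightarrow> entails \<Gamma> (PAtom ((Sc ^^ k) u) c)"
    using entails_Eql_right[OF eq xtu, of "(Sc ^^ k) (Var x)" c] by (simp add: c tsubst_iter)
qed

lemmas PAtom_left = entails_PAtom_left[where k = 0, simplified]
lemmas PAtom_right = entails_PAtom_right[where k = 0, simplified]
lemmas PAtom_right_Sc = entails_PAtom_right[where k = 1, simplified]
lemmas PAtom_left_Sc = entails_PAtom_left[where k = 1, simplified]
lemmas PAtom_left' = entails_PAtom_left'[where k = 0, simplified]

text \<open>Instantiating the outer quantifier of \<open>hydra_b\<close> shifts the term under the
  inner one; instantiating the inner one undoes the shift.\<close>

lemma tsubst_case_nat_lift: "tsubst (case_nat t Var) (tsubst (\<lambda>y. Var (Suc y)) u) = u"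
  by (induction u) auto

lemma entails_hydra_a:
  assumes "hydra_a |\<in>| \<Gamma>" "NAtom t |\<in>| \<Gamma>"
    and "A \<in> {PAtom Zero Zero, PAtom one Zero, PAtom t one}"
  shows "entails \<Gamma> A"
proof (rule entails_AllN)
  let ?C = "Conj (PAtom one Zero) (PAtom t one)"
  let ?I = "Conj (PAtom Zero Zero) ?C"
  have "entails (finsert (PAtom one Zero) (finsert (PAtom t one)
      (finsert (PAtom Zero Zero) (finsert ?C (finsert ?I \<Gamma>))))) A"
    using assms(3) by (intro entails_assumption) auto
  then have "entails (finsert (PAtom Zero Zero) (finsert ?C (finsert ?I \<Gamma>))) A"
    by (rule entails_Conj[rotated]) simp
  then have "entails (finsert ?I \<Gamma>) A"
    by (rule entails_Conj[rotated]) simp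
  then show "entails (finsert (inst (Conj (PAtom Zero Zero) (Conj (PAtom one Zero) (PAtom (Var 0) one))) t) \<Gamma>) A"
    by (simp add: inst_def)
qed (use assms in \<open>simp_all add: hydra_a_def\<close>)

lemma entails_AllN_Imp:
  assumes "AllN (Imp A B) |\<in>| \<Gamma>" "NAtom t |\<in>| \<Gamma>" "entails \<Gamma> (inst A t)"
  shows "entails \<Gamma> (inst B t)"
proof (rule entails_AllN[OF assms(1,2)])
  show "entails (finsert (inst (Imp A B) t) \<Gamma>) (inst B t)"
  proof (rule entails_Imp)
    show "entails (finsert (inst (Imp A B) t) \<Gamma>) (inst A t)"
      using assms(3) by (rule entails_mono) auto
    show "Imp (inst A t) (inst B t) |\<in>| finsert (inst (Imp A B) t) \<Gamma>" by (simp add: inst_def)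
  qed (simp add: entails_assumption)
qed

lemma entails_hydra_b:
  assumes "hydra_b |\<in>| \<Gamma>" "NAtom t |\<in>| \<Gamma>" "NAtom u |\<in>| \<Gamma>" "entails \<Gamma> (PAtom t u)"
  shows "entails \<Gamma> (PAtom (Sc t) (Sc (Sc u)))"
proof (rule entails_AllN)
  let ?A = "Imp (PAtom (Var 1) (Var 0)) (PAtom (Sc (Var 1)) (Sc (Sc (Var 0))))"
  let ?t = "tsubst (\<lambda>y. Var (Suc y)) t"
  let ?I = "AllN (Imp (PAtom ?t (Var 0)) (PAtom (Sc ?t) (Sc (Sc (Var 0)))))"
  have "entails (finsert ?I \<Gamma>) (PAtom t u)" using assms(4) by (rule entails_mono) auto
  then have "entails (finsert ?I \<Gamma>) (PAtom (Sc t) (Sc (Sc u)))"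
    using entails_AllN_Imp[of "PAtom ?t (Var 0)" "PAtom (Sc ?t) (Sc (Sc (Var 0)))" "finsert ?I \<Gamma>" u] assms(3)
    by (simp add: inst_def tsubst_case_nat_lift)
  then show "entails (finsert (inst (AllN ?A) t) \<Gamma>) (PAtom (Sc t) (Sc (Sc u)))"
    by (simp add: inst_def AllN_def lift_def)
qed (use assms in \<open>simp_all add: hydra_b_def\<close>)

lemma entails_hydra_c:
  assumes "hydra_c |\<in>| \<Gamma>" "NAtom u |\<in>| \<Gamma>" "entails \<Gamma> (PAtom (Sc u) u)"
  shows "entails \<Gamma> (PAtom Zero (Sc (Sc u)))"
  using entails_AllN_Imp[OF assms(1)[unfolded hydra_c_def] assms(2)] assms(3) by (simp add: inst_def)

lemma entails_hydra_d:
  assumes "hydra_d |\<in>| \<Gamma>" "NAtom u |\<in>| \<Gamma>" "entails \<Gamma> (PAtom (Sc u) u)"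
  shows "entails \<Gamma> (PAtom (Sc (Sc u)) Zero)"
  using entails_AllN_Imp[OF assms(1)[unfolded hydra_d_def] assms(2)] assms(3) by (simp add: inst_def)

lemma fvs_finsert: "fvs (finsert A \<Gamma>) = fv A \<union> fvs \<Gamma>" and fvs_empty: "fvs {||} = {}"
  by (auto simp: fvs_def)

lemma provable_empty_of_entails: "entails \<Gamma> B \<Longrightarrow> provable (\<Gamma> \<turnstile> {|B|}) {}"
  by (simp add: entails_def)

section \<open>The cyclic proof of the hydra formula\<close>

text \<open>The three pairs belong to the loops closed by \<open>hydra_b\<close>,
  \<open>hydra_c\<close> and \<open>hydra_d\<close>, in this order.\<close>

lemma provable_hydra_loop:
  "provable hydra_loop
    {((NAtom (Var 0), True), (NAtom (Var 1), True)), ((NAtom (Var 1), True), (NAtom (Var 1), True)),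
     ((NAtom (Var 0), True), (NAtom (Var 0), True))}" (is "provable _ ?K")
proof -
  let ?N = "\<lambda>i. NAtom (Var i)" and ?zero = "\<lambda>i. Eql (Var i) Zero"
    and ?suc = "\<lambda>i j. Eql (Var i) (Sc (Var j))" and ?B = "PAtom (Var 0) (Var 1)"
  \<comment> \<open>Variables 0 to 5 are x, y, x', x'', y', y''. L and R mean that x is zero or a
    successor; the digits 1 and 2 say the same of the later splits.\<close>
  let ?G = "{|?N 0, ?N 1, hydra_a, hydra_b, hydra_c, hydra_d|}"
  let ?L = "finsert (?zero 0) ?G"
  let ?L2 = "finsert (?suc 1 4) (finsert (?N 4) ?L)"
  let ?L22 = "finsert (?suc 4 5) (finsert (?N 5) ?L2)"
  let ?R = "finsert (?suc 0 2) (finsert (?N 2) ?G)"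
  let ?R1 = "finsert (?zero 1) ?R"
  let ?R12 = "finsert (?suc 2 3) (finsert (?N 3) ?R1)"
  let ?R2 = "finsert (?suc 1 4) (finsert (?N 4) ?R)"
  let ?R22 = "finsert (?suc 4 5) (finsert (?N 5) ?R2)"
  note fvs = fvs_finsert fvs_empty fv_hydra_hyps
  have one: "entails \<Gamma> ?B"
    if "hydra_a |\<in>| \<Gamma>" "?N 0 |\<in>| \<Gamma>" "?suc 1 4 |\<in>| \<Gamma>" "?zero 4 |\<in>| \<Gamma>" for \<Gamma>
    using that by (intro PAtom_right[OF that(3)] PAtom_right_Sc[OF that(4)] entails_hydra_a) auto
  have L1: "entails (finsert (?zero 1) ?L) ?B"
    by (rule PAtom_left[of _ Zero], simp, rule PAtom_right[of _ Zero], simp,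
        rule entails_hydra_a[of _ "Var 0"]) simp_all
  have "entails (finsert (PAtom (Var 4) (Var 5)) ?L22) ?B" (is "entails ?\<Gamma> _")
  proof -
    have "entails ?\<Gamma> (PAtom (Sc (Var 5)) (Var 5))"
      by (rule PAtom_left'[of "Var 4"]) (simp_all add: entails_assumption)
    then have "entails ?\<Gamma> (PAtom Zero (Sc (Sc (Var 5))))"
      by (intro entails_hydra_c) simp_all
    then have "entails ?\<Gamma> (PAtom Zero (Sc (Var 4)))"
      by (rule PAtom_right_Sc[rotated]) simp
    then have "entails ?\<Gamma> (PAtom Zero (Var 1))"
      by (rule PAtom_right[rotated]) simp
    then show ?thesis by (rule PAtom_left[rotated]) simp
  qed
  then have L22: "provable (?L22 \<turnstile> {|?B|}) {((?N 4, False), (?N 5, False))}"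
    by (intro provable_cut_loop) auto
  \<comment> \<open>Both threads start from y': one waits there, the other descends to y''.\<close>
  have L2: "provable (?L2 \<turnstile> {|?B|}) {((?N 4, False), (?N 4, False))}"
    by (rule provable_CaseSplit[OF _ _ provable_empty_of_entails[OF one] L22]) (simp_all add: fvs)
  \<comment> \<open>The split of y gives both threads their progress.\<close>
  have L: "provable (?L \<turnstile> {|?B|}) {((?N 1, True), (?N 1, True))}"
    by (rule provable_CaseSplit[OF _ _ provable_empty_of_entails[OF L1] L2]) (simp_all add: fvs)
  have R11: "entails (finsert (?zero 2) ?R1) ?B"
    by (rule PAtom_left[of _ "Sc (Var 2)"], simp, rule PAtom_left_Sc[of _ Zero], simp,
        rule PAtom_right[of _ Zero], simp, rule entails_hydra_a[of _ "Var 0"]) simp_all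
  have "entails (finsert (PAtom (Var 2) (Var 3)) ?R12) ?B" (is "entails ?\<Gamma> _")
  proof -
    have "entails ?\<Gamma> (PAtom (Sc (Var 3)) (Var 3))"
      by (rule PAtom_left'[of "Var 2"]) (simp_all add: entails_assumption)
    then have "entails ?\<Gamma> (PAtom (Sc (Sc (Var 3))) Zero)"
      by (intro entails_hydra_d) simp_all
    then have "entails ?\<Gamma> (PAtom (Sc (Var 2)) Zero)"
      by (rule PAtom_left_Sc[rotated]) simp
    then have "entails ?\<Gamma> (PAtom (Var 0) Zero)"
      by (rule PAtom_left[rotated]) simp
    then show ?thesis by (rule PAtom_right[rotated]) simp
  qed
  then have R12: "provable (?R12 \<turnstile> {|?B|}) {((?N 2, False), (?N 3, False))}"
    by (intro provable_cut_loop) auto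
  have R1: "provable (?R1 \<turnstile> {|?B|}) {((?N 2, False), (?N 2, False))}"
    by (rule provable_CaseSplit[OF _ _ provable_empty_of_entails[OF R11] R12]) (simp_all add: fvs)
  have "entails (finsert (PAtom (Var 2) (Var 5)) ?R22) ?B" (is "entails ?\<Gamma> _")
  proof -
    have "entails ?\<Gamma> (PAtom (Sc (Var 2)) (Sc (Sc (Var 5))))"
      by (intro entails_hydra_b entails_assumption) simp_all
    then have "entails ?\<Gamma> (PAtom (Sc (Var 2)) (Sc (Var 4)))"
      by (rule PAtom_right_Sc[rotated]) simp
    then have "entails ?\<Gamma> (PAtom (Sc (Var 2)) (Var 1))"
      by (rule PAtom_right[rotated]) simp
    then show ?thesis by (rule PAtom_left[rotated]) simp
  qed
  then have R22: "provable (?R22 \<turnstile> {|?B|}) {((?N 2, False), (?N 5, False))}"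
    by (intro provable_cut_loop) auto
  have R2: "provable (?R2 \<turnstile> {|?B|}) {((?N 2, False), (?N 4, False))}"
    by (rule provable_CaseSplit[OF _ _ provable_empty_of_entails[OF one] R22]) (simp_all add: fvs)
  \<comment> \<open>Threads on x' progress at the split of x nearer to the root, so their flags are
    False here; the thread on y' progresses at this split, which is why y carries True.\<close>
  have R: "provable (?R \<turnstile> {|?B|})
      {((?N 2, False), (?N 2, False)), ((?N 2, False), (?N 1, True))}"
    by (rule provable_CaseSplit[OF _ _ R1 R2]) (simp_all add: fvs)
  show ?thesis
    unfolding hydra_loop_def
    by (rule provable_CaseSplit[OF _ _ L R]) (simp_all add: fvs)
qed

section \<open>From the looping tree to a cyclic proof of the formula\<close>

text \<open>Between \<open>H\<close> and \<open>hydra_loop\<close> the two \<open>NAtom\<close>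
  hypotheses are not both present, so threads cannot be kept there. It is recorded instead that all
  leaves recur in \<open>u\<close> and that every path enters \<open>u\<close>.\<close>

definition above :: "dtree \<Rightarrow> sequent \<Rightarrow> bool" where
  "above u S \<longleftrightarrow> (\<exists>d p. derivation d \<and> root_seq d = S \<and> subtree_at d p = Some u \<and>
    (\<forall>q S'. subtree_at d q = Some (Leaf S') \<longrightarrow> (\<exists>q'. subtree_at u q' = Some (Leaf S'))) \<and>
    (\<forall>X \<pi> k. (\<forall>i. \<pi> (Suc i) \<in> set (uchildren (\<pi> i))) \<and> \<pi> k = plug X d \<longrightarrow> (\<exists>m. \<pi> m = plug X u)))"

lemma above_root: "derivation u \<Longrightarrow> above u (root_seq u)"
  unfolding above_def by (rule exI[of _ u], rule exI[of _ "[]"]) auto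

lemma above_step:
  assumes "above u S'" "common_rule Other [S'] S"
  shows "above u S"
proof -
  obtain d p where d: "derivation d" "root_seq d = S'" "subtree_at d p = Some u"
    "\<And>q S'. subtree_at d q = Some (Leaf S') \<Longrightarrow> \<exists>q'. subtree_at u q' = Some (Leaf S')"
    "\<And>X \<pi> k. (\<forall>i. \<pi> (Suc i) \<in> set (uchildren (\<pi> i))) \<Longrightarrow> \<pi> k = plug X d \<Longrightarrow> \<exists>m. \<pi> m = plug X u"
    using assms(1) unfolding above_def by blast
  let ?d = "Inner S Other [d]"
  have "derivation ?d" using d(1,2) assms(2) by (simp add: CLKID_rule.intros(1))
  moreover have "subtree_at ?d (0 # p) = Some u" using d(3) by simp
  moreover have "\<exists>q'. subtree_at u q' = Some (Leaf S'')" if "subtree_at ?d q = Some (Leaf S'')" for q S''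
    using that d(4) by (cases q) (auto split: if_splits)
  moreover have "\<exists>m. \<pi> m = plug X u" if "\<forall>i. \<pi> (Suc i) \<in> set (uchildren (\<pi> i))" "\<pi> k = plug X ?d" for X \<pi> k
  proof -
    have "\<pi> (Suc k) = plug X d" using that(1)[rule_format, of k] that(2) by simp
    then show ?thesis using d(5) that(1) by blast
  qed
  ultimately show ?thesis
    unfolding above_def 
    by - (rule exI[of _ ?d], rule exI[of _ "0 # p"], auto simp del: derivation.simps subtree_at.simps plug.simps)
qed

text \<open>The rules are applied from \<open>hydra_loop\<close> down, with eigenvariables 1 for y
  and 0 for x, so that the topmost premise is literally \<open>hydra_loop\<close>.\<close>

lemma above_hydra:
  assumes "above u hydra_loop" shows "above u ({||} \<turnstile> {|hydra|})"
proof -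
  let ?G = "AllN (AllN (PAtom (Var 1) (Var 0)))"
  let ?C2 = "Conj hydra_c hydra_d"
  let ?C1 = "Conj hydra_b ?C2"
  let ?C0 = "Conj hydra_a ?C1"
  have fvs: "fvs hydra_hyps = {}" by (auto simp: fvs_def fv_hydra_hyps)
  have "common_rule Other [hydra_loop]
      (finsert (NAtom (Var 0)) hydra_hyps \<turnstile> {|Imp (NAtom (Var 1)) (PAtom (Var 0) (Var 1))|})"
    using ImpR[of "NAtom (Var 1)" "finsert (NAtom (Var 0)) hydra_hyps" "PAtom (Var 0) (Var 1)" "{||}"]
    by (simp add: hydra_loop_def finsert_commute)
  note 1 = above_step[OF assms this]
  have "common_rule Other
      [finsert (NAtom (Var 0)) hydra_hyps \<turnstile> {|Imp (NAtom (Var 1)) (PAtom (Var 0) (Var 1))|}]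
      (finsert (NAtom (Var 0)) hydra_hyps \<turnstile> {|AllN (PAtom (Var 1) (Var 0))|})"
    using AllR[of 1 "finsert (NAtom (Var 0)) hydra_hyps" "{||}" "Imp (NAtom (Var 0)) (PAtom (Var 1) (Var 0))"]
    by (simp add: inst_def AllN_def fvs_finsert fvs_empty fv_hydra_hyps)
  note 2 = above_step[OF 1 this]
  have "common_rule Other
      [finsert (NAtom (Var 0)) hydra_hyps \<turnstile> {|AllN (PAtom (Var 1) (Var 0))|}]
      (hydra_hyps \<turnstile> {|Imp (NAtom (Var 0)) (AllN (PAtom (Var 1) (Var 0)))|})"
    by (rule ImpR)
  note 3 = above_step[OF 2 this]
  have "common_rule Other
      [hydra_hyps \<turnstile> {|Imp (NAtom (Var 0)) (AllN (PAtom (Var 1) (Var 0)))|}] (hydra_hyps \<turnstile> {|?G|})"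
    using AllR[of 0 hydra_hyps "{||}" "Imp (NAtom (Var 0)) (AllN (PAtom (Var 1) (Var 0)))"]
    by (simp add: inst_def AllN_def lift_def fvs_finsert fvs_empty fv_hydra_hyps)
  note 4 = above_step[OF 3 this]
  have "common_rule Other [hydra_hyps \<turnstile> {|?G|}] ({|?C2, hydra_a, hydra_b|} \<turnstile> {|?G|})"
    using ConjL[of hydra_c hydra_d "{|hydra_a, hydra_b|}" "{|?G|}"]
    by (simp add: finsert_commute)
  note 5 = above_step[OF 4 this]
  have "common_rule Other [{|?C2, hydra_a, hydra_b|} \<turnstile> {|?G|}] ({|?C1, hydra_a|} \<turnstile> {|?G|})"
    using ConjL[of hydra_b ?C2 "{|hydra_a|}" "{|?G|}"]
    by (simp add: finsert_commute)
  note 6 = above_step[OF 5 this]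
  have "common_rule Other [{|?C1, hydra_a|} \<turnstile> {|?G|}] ({|?C0|} \<turnstile> {|?G|})"
    using ConjL[of hydra_a ?C1 "{||}" "{|?G|}"]
    by (simp add: finsert_commute)
  note 7 = above_step[OF 6 this]
  have "common_rule Other [{|?C0|} \<turnstile> {|?G|}] ({||} \<turnstile> {|hydra|})"
    unfolding hydra_def by (rule ImpR)
  then show ?thesis by (rule above_step[OF 7])
qed

text \<open>One round from the companion back to it. A Boolean \<open>b\<close> names the final
  atom, False for \<open>Var 0\<close> and True for \<open>Var 1\<close>, and \<open>G b\<close> the
  atom where its thread starts. The three pairs become the identity and the two constant
  maps.\<close>

lemma trace_segment_loop:
  assumes t: "threaded t {((NAtom (Var 0), True), (NAtom (Var 1), True)),
      ((NAtom (Var 1), True), (NAtom (Var 1), True)),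
      ((NAtom (Var 0), True), (NAtom (Var 0), True))}" "\<nexists>S. t = Leaf S"
    and path: "\<And>i. \<pi> (Suc i) \<in> set (uchildren (\<pi> i))" and k: "\<pi> k = plug X t"
  shows "\<exists>j G \<tau>. k < j \<and> \<pi> j = X \<and> G \<in> {id, \<lambda>_. True, \<lambda>_. False} \<and>
    (\<forall>b. trace_segment \<pi> k j (NAtom (Var (of_bool (G b))), True) (NAtom (Var (of_bool b))) (\<tau> b))"
proof -
  obtain n P Q \<tau> \<tau>' where n: "(P, Q) \<in> {((NAtom (Var 0), True), (NAtom (Var 1), True)),
      ((NAtom (Var 1), True), (NAtom (Var 1), True)), ((NAtom (Var 0), True), (NAtom (Var 0), True))}"
    "\<pi> (k + n) = X" "trace_segment \<pi> k (k + n) P (NAtom (Var 0)) \<tau>"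
    "trace_segment \<pi> k (k + n) Q (NAtom (Var 1)) \<tau>'" "0 < n"
    using threaded_path[OF t(1) path k] t(2) by blast
  obtain G :: "bool \<Rightarrow> bool" where G: "G \<in> {id, \<lambda>_. True, \<lambda>_. False}"
    "P = (NAtom (Var (of_bool (G False))), True)" "Q = (NAtom (Var (of_bool (G True))), True)"
  proof -
    consider "P = (NAtom (Var 0), True)" "Q = (NAtom (Var 1), True)"
      | "P = (NAtom (Var 1), True)" "Q = (NAtom (Var 1), True)"
      | "P = (NAtom (Var 0), True)" "Q = (NAtom (Var 0), True)"
      using n(1) by auto
    then show ?thesis
    proof cases
      case 1
      then show ?thesis by (intro that[of id]) simp_all
    next
      case 2
      then show ?thesis by (intro that[of "\<lambda>_. True"]) simp_all
    next
      case 3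
      then show ?thesis by (intro that[of "\<lambda>_. False"]) simp_all
    qed
  qed
  have "trace_segment \<pi> k (k + n) (NAtom (Var (of_bool (G b))), True) (NAtom (Var (of_bool b)))
      (if b then \<tau>' else \<tau>)" for b
    using n(3,4) G(2,3) by (cases b) simp_all
  then show ?thesis using n(2,5) G(1)
    by - (rule exI[of _ "k + n"], rule exI[of _ G], rule exI[of _ "\<lambda>b. if b then \<tau>' else \<tau>"], simp)
qed

lemma hydra_cyclic: "CLKID_omega ({||} \<turnstile> {|hydra|})"
proof -
  obtain t where t: "root_seq t = hydra_loop"
    "threaded t {((NAtom (Var 0), True), (NAtom (Var 1), True)),
      ((NAtom (Var 1), True), (NAtom (Var 1), True)),
      ((NAtom (Var 0), True), (NAtom (Var 0), True))}"
    using provable_hydra_loop unfolding provable_def by blast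
  \<comment> \<open>The companion has to be an inner node, and a round has to take at least one
    step.\<close>
  have nl: "\<nexists>S. t = Leaf S"
  proof
    assume "\<exists>S. t = Leaf S"
    then obtain S where S: "t = Leaf S" ..
    from t(2) show False by cases (use S t(1) not_axiom_hydra_loop in auto)
  qed
  then obtain r ds where tI: "t = Inner hydra_loop r ds" using t(1) by (cases t) auto
  have "above t ({||} \<turnstile> {|hydra|})"
    using above_root[OF threaded_derivation[OF t(2)]] t(1) by (intro above_hydra) simp
  then obtain d p where d: "derivation d" "root_seq d = ({||} \<turnstile> {|hydra|})" "subtree_at d p = Some t"
    and leaf: "\<And>q S. subtree_at d q = Some (Leaf S) \<Longrightarrow> \<exists>q'. subtree_at t q' = Some (Leaf S)"
    and down: "\<And>X \<pi> k. \<forall>i. \<pi> (Suc i) \<in> set (uchildren (\<pi> i)) \<Longrightarrow> \<pi> k = plug X d \<Longrightarrow> \<exists>m. \<pi> m = plug X t"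
    unfolding above_def by blast
  have bud: "S = hydra_loop" if "bud d q S" for q S
    using that leaf threaded_leaf[OF t(2)] unfolding bud_def by blast
  let ?c = "\<lambda>_ :: pos. p"
  let ?X = "unfolding_from d ?c p"
  have p: "subtree_at d p = Some (Inner hydra_loop r ds)" using d(3) tI by simp
  have "cyclic_preproof d ?c"
    unfolding cyclic_preproof_def using d(1) p bud by blast
  moreover have "global_trace_condition (unfolding_from d ?c [])"
    unfolding global_trace_condition_def
  proof (intro allI impI)
    fix \<pi> assume \<pi>: "infinite_path (unfolding_from d ?c []) \<pi>"
    then have path: "\<And>i. \<pi> (Suc i) \<in> set (uchildren (\<pi> i))" by (simp add: infinite_path_def)
    \<comment> \<open>The unfolding at the companion contains itself at every bud, so a path in it
      goes round forever.\<close>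
    have X: "?X = plug ?X t" using unfolding_from_plug[OF p d(3)] .
    have "\<pi> 0 = plug ?X d" using \<pi> unfolding_from_plug[OF p, of "[]"] by (simp add: infinite_path_def)
    then obtain m where m: "\<pi> m = ?X" using down path X by metis
    have "\<exists>j G \<tau>. k < j \<and> \<pi> j = ?X \<and> G \<in> {id, \<lambda>_. True, \<lambda>_. False} \<and>
        (\<forall>b. trace_segment \<pi> k j (NAtom (Var (of_bool (G b))), True) (NAtom (Var (of_bool b))) (\<tau> b))"
      if "\<pi> k = ?X" for k
      using trace_segment_loop[OF t(2) nl, of \<pi> k ?X] path that X by simp
    then obtain J G \<tau> where J: "\<And>k. \<pi> k = ?X \<Longrightarrow> k < J k \<and> \<pi> (J k) = ?X \<and>
        G k \<in> {id, \<lambda>_. True, \<lambda>_. False} \<and> (\<forall>b. trace_segment \<pi> k (J k)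
          (NAtom (Var (of_bool (G k b))), True) (NAtom (Var (of_bool b))) (\<tau> k b))"
      by metis
    define s where "s r = (J ^^ r) m" for r
    have s: "\<pi> (s r) = ?X" for r
      by (induction r) (use m J in \<open>auto simp: s_def\<close>)
    have sS: "s (Suc r) = J (s r)" for r by (simp add: s_def)
    have "strict_mono s" using J s by (simp add: strict_mono_Suc_iff sS)
    \<comment> \<open>The end of a round determines where its thread starts, so the choices are made
      backwards from later rounds.\<close>
    moreover obtain \<sigma> where \<sigma>: "\<And>r. \<sigma> r = G (s r) (\<sigma> (Suc r))"
      using backward_choice[of "\<lambda>r. G (s r)"] J[OF s] by blast
    have "trace_segment \<pi> (s r) (s (Suc r)) (NAtom (Var (of_bool (\<sigma> r))), True)
        (NAtom (Var (of_bool (\<sigma> (Suc r))))) (\<tau> (s r) (\<sigma> (Suc r)))" for r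
      using J[OF s, of r] unfolding sS[symmetric] by (subst \<sigma>) blast
    ultimately show "\<exists>k \<tau>. is_trace (\<lambda>i. \<pi> (k + i)) \<tau> \<and>
        infinite {i. progress_point (\<lambda>i. \<pi> (k + i)) \<tau> i}"
      by (intro exI[of _ "s 0"] trace_glue)
  qed
  ultimately show ?thesis unfolding CLKID_omega_def cyclic_proof_def using d(2) by blast
qed

theorem theorem8p3:
  shows "CLKID_omega ({||} \<turnstile> {|hydra|}) \<and> \<not> LKID zero_s_axioms ({||} \<turnstile> {|hydra|})"
  using hydra_cyclic not_LKID_hydra by blast

end
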